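(* Let $n\ge2$, $s>1$, $p\in(1,\infty)$, $\lambda\in[n-1,n)$ and $\delta,\tau\in(0,1)$, and suppose \[ s<\frac{n+1-\lambda}{1-\delta},\qquad p\le\frac{s(n-1)-\lambda+1}{n-s(1-\delta)-\lambda+1}. \] Then there is an $s$-John domain $G_s\subset\mathbb{R}^n$ with $\dim_{\mathcal M}(\partial G_s)=\lambda$ which does not support the fractional $(1,p)$-Poincaré inequality with parameters $\delta,\tau$, i.e. there is no $c<\infty$ such that for all $u\in L^p(G_s)$ \[ \int_{G_s}|u(x)-u_{G_s}|\,dx\le c\left(\int_{G_s}\int_{G_s\cap B^n(x,\tau\operatorname{dist}(x,\partial G_s))}\frac{|u(x)-u(y)|^p}{|x-y|^{n+\delta p}}\,dy\,dx\right)^{1/p}. \]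
   Context: A bounded domain $G\subset\mathbb{R}^n$ is an $s$-John domain ($s\ge1$) if there are $x_0\in G$ and $c>0$ such that every $x\in G$ can be joined to $x_0$ by a rectifiable arc-length parametrized curve $\gamma:[0,l]\to G$ with $\gamma(0)=x$, $\gamma(l)=x_0$, $l\le c$, and $\operatorname{dist}(\gamma(t),\partial G)\ge t^s/c$ for $t\in[0,l]$. Upper Minkowski dimension: $\dim_{\mathcal M}(E)=\sup\{\lambda\ge0:\limsup_{r\to0+}|E+B^n(0,r)|\,r^{\lambda-n}=\infty\}$. $u_{G_s}$ is the mean of $u$ over $G_s$. *)

theory Defs
  imports "HOL-Analysis.Analysis"
begin

text \<open>Length (total variation) of a curve gamma on the parameter interval [a,b],
  as a supremum over finite partitions a = t_0 <= ... <= t_k = b (extended real,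
  so that non-rectifiable curves get length infinity).\<close>
definition curve_length :: "(real \<Rightarrow> 'a::metric_space) \<Rightarrow> real \<Rightarrow> real \<Rightarrow> ereal" where
  "curve_length \<gamma> a b =
     (SUP tk \<in> {(t, k). t (0::nat) = a \<and> t k = b \<and> (\<forall>i<k. t i \<le> t (Suc i))}.
        ereal (\<Sum>i<snd tk. dist (\<gamma> (fst tk i)) (\<gamma> (fst tk (Suc i)))))"

definition arclength_param :: "(real \<Rightarrow> 'a::metric_space) \<Rightarrow> real \<Rightarrow> bool" where
  "arclength_param \<gamma> l \<longleftrightarrow> 0 \<le> l \<and>
     (\<forall>a b. 0 \<le> a \<and> a \<le> b \<and> b \<le> l \<longrightarrow> curve_length \<gamma> a b = ereal (b - a))"

definition john_domain :: "real \<Rightarrow> 'a::euclidean_space set \<Rightarrow> bool" where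
  "john_domain s G \<longleftrightarrow> s \<ge> 1 \<and> bounded G \<and> open G \<and> connected G \<and>
     (\<exists>x0\<in>G. \<exists>c>0. \<forall>x\<in>G. \<exists>\<gamma> l. arclength_param \<gamma> l \<and> l \<le> c \<and>
        \<gamma> 0 = x \<and> \<gamma> l = x0 \<and> \<gamma> ` {0..l} \<subseteq> G \<and>
        (\<forall>t\<in>{0..l}. infdist (\<gamma> t) (frontier G) \<ge> t powr s / c))"

text \<open>Upper Minkowski dimension:
  sup {lam >= 0. limsup_{r->0+} |E + B(0,r)| r^(lam - n) = infinity}, with sup of empty set = 0.\<close>
definition upper_minkowski_dim :: "'a::euclidean_space set \<Rightarrow> ereal" where
  "upper_minkowski_dim E =
     Sup (insert 0 (ereal ` {lam. lam \<ge> 0 \<and>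
        Limsup (at_right 0)
          (\<lambda>r. emeasure lborel {x + y | x y. x \<in> E \<and> y \<in> ball 0 r}
               * ennreal (r powr (lam - real DIM('a)))) = \<infinity>}))"

definition enn_powr :: "ennreal \<Rightarrow> real \<Rightarrow> ennreal" where
  "enn_powr x q = (if x = \<infinity> then \<infinity> else ennreal (enn2real x powr q))"

definition in_Lp :: "real \<Rightarrow> 'a::euclidean_space set \<Rightarrow> ('a \<Rightarrow> real) \<Rightarrow> bool" where
  "in_Lp p G u \<longleftrightarrow> (\<lambda>x. indicator G x * u x) \<in> borel_measurable lebesgue \<and>
     (\<integral>\<^sup>+ x. ennreal (\<bar>u x\<bar> powr p) * indicator G x \<partial>lebesgue) < \<infinity>"

definition mean_over :: "'a::euclidean_space set \<Rightarrow> ('a \<Rightarrow> real) \<Rightarrow> real" where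
  "mean_over G u = (LINT x:G|lebesgue. u x) / measure lebesgue G"

definition fractional_poincare :: "real \<Rightarrow> real \<Rightarrow> real \<Rightarrow> 'a::euclidean_space set \<Rightarrow> bool" where
  "fractional_poincare p \<delta> \<tau> G \<longleftrightarrow>
     (\<exists>c::real. \<forall>u. in_Lp p G u \<longrightarrow>
        (\<integral>\<^sup>+ x. ennreal \<bar>u x - mean_over G u\<bar> * indicator G x \<partial>lebesgue)
        \<le> ennreal c * enn_powr
            (\<integral>\<^sup>+ x. (\<integral>\<^sup>+ y. ennreal (\<bar>u x - u y\<bar> powr p / dist x y powr (real DIM('a) + \<delta> * p))
                  * indicator (G \<inter> ball x (\<tau> * infdist x (frontier G))) y \<partial>lebesgue)
               * indicator G x \<partial>lebesgue) (1 / p))"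

end

theory Submission
  imports Defs
begin

text \<open>The domain is a tree of open boxes with passages and rooms. Put \<open>\<kappa> = 2 powr - (1 / \<lambda>)\<close>. Level \<open>k\<close> consists of
  \<open>2 ^ k\<close> bars of length about \<open>\<kappa> ^ k\<close>, a generalized H-tree: the bar of a word is centred at an end of
  its parent's bar, and the directions run cyclically through the coordinate axes. As \<open>\<kappa> ^ n < 1 / 2\<close>,
  the branches stay apart, and counting boxes gives boundary dimension \<open>\<lambda>\<close>. To each bar of level \<open>k\<close> a
  room of size about \<open>\<kappa> ^ k\<close> is attached by a tube of the same length and of width about
  \<open>(\<kappa> ^ k) powr s\<close>, which is just wide enough for the \<open>s\<close>-John condition.

  Let \<open>u\<close> be \<open>(\<kappa> ^ k) powr (\<lambda> - n)\<close> on the rooms of level \<open>k < K\<close>, falling linearly to \<open>0\<close> along the tubes.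
  Each level contributes a fixed amount to the integral of \<open>u\<close>, and \<open>u\<close> vanishes on a fixed bar, so the
  left-hand side of the inequality is at least a multiple of \<open>K\<close>. Only points near the tubes contribute
  to the energy, and the bound on \<open>p\<close> says exactly that each level contributes a bounded amount, so
  that the right-hand side is at most a multiple of \<open>K powr (1 / p)\<close>.\<close>

section \<open>John domains from chains of segments\<close>

text \<open>The choice of \<kappa> means \<open>2 ^ k * (\<kappa> ^ k) powr \<lambda> = 1\<close>:
  all levels carry the same \<lambda>-dimensional content, and every estimate becomes a comparison
  of powers of \<open>X = \<kappa> ^ k\<close>. An axis recurs after n levels, when lengths have
  dropped by \<open>\<kappa> ^ n\<close>, so the moves along one axis form a geometric series of
  ratio below 1/2. Hence a gap remains between the subtrees at the two ends of a bar, and the room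
  hides in it. The gap has to be quantitative, since infinitely many branches accumulate at the
  boundary.

  Two points shape the analytic half. At equality in the bound on p the energy estimate of a level
  does not improve with k, so no single level is enough; levels must be superposed, and p > 1 then
  decides. And the inner integral only sees y within \<tau> times the boundary distance of x: if u
  differs at x and y, the segment between them meets a thin tube, so x is itself close to the
  boundary, at distance comparable to the tube's width. This confines the energy to thin slabs
  around the tubes.\<close>

inductive geodesic_chain :: "(real \<Rightarrow> 'a::metric_space) \<Rightarrow> real \<Rightarrow> real \<Rightarrow> bool" for \<gamma> where
  refl: "geodesic_chain \<gamma> a a"
| step: "geodesic_chain \<gamma> a c \<Longrightarrow> c \<le> b \<Longrightarrow> dist (\<gamma> c) (\<gamma> b) = b - c \<Longrightarrow> geodesic_chain \<gamma> a b"

lemma geodesic_chain_trans: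
  assumes "geodesic_chain \<gamma> b c" "geodesic_chain \<gamma> a b"
  shows "geodesic_chain \<gamma> a c"
  using assms by (induction rule: geodesic_chain.induct) (auto intro: geodesic_chain.step)

lemma geodesic_chain_dist_le:
  assumes "geodesic_chain \<gamma> a b"
  shows "dist (\<gamma> a) (\<gamma> b) \<le> b - a"
  using assms
proof (induction rule: geodesic_chain.induct)
  case (step a c b)
  then show ?case using dist_triangle[of "\<gamma> a" "\<gamma> b" "\<gamma> c"] by linarith
qed simp

lemma geodesic_chain_partition:
  assumes "geodesic_chain \<gamma> a b"
  shows "\<exists>t k. t (0::nat) = a \<and> t k = b \<and> (\<forall>i<k. t i \<le> t (Suc i)) \<and>
           (\<Sum>i<k. dist (\<gamma> (t i)) (\<gamma> (t (Suc i)))) = b - a"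
  using assms
proof (induction rule: geodesic_chain.induct)
  case (refl a)
  show ?case by (rule exI[of _ "\<lambda>_. a"], rule exI[of _ 0]) simp
next
  case (step a c b)
  then obtain t k where t: "t (0::nat) = a" "t k = c" "\<forall>i<k. t i \<le> t (Suc i)"
    "(\<Sum>i<k. dist (\<gamma> (t i)) (\<gamma> (t (Suc i)))) = c - a" by blast
  define t' where "t' = t(Suc k := b)"
  have eq: "(\<Sum>i<k. dist (\<gamma> (t' i)) (\<gamma> (t' (Suc i)))) = (\<Sum>i<k. dist (\<gamma> (t i)) (\<gamma> (t (Suc i))))"
    by (intro sum.cong) (auto simp: t'_def)
  have "(\<Sum>i<Suc k. dist (\<gamma> (t' i)) (\<gamma> (t' (Suc i)))) = b - a"
    using step.hyps(3) t(2,4) eq by (simp add: t'_def)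
  moreover have "t' 0 = a" "t' (Suc k) = b" "\<forall>i<Suc k. t' i \<le> t' (Suc i)"
    using t step.hyps(2) by (auto simp: t'_def less_Suc_eq)
  ultimately show ?case by blast
qed

text \<open>Demanded of every subinterval, because an arc-length parametrization must have the right
  length on each of them. Polygonal curves satisfy it with finitely many exact distances.\<close>

definition unit_speed :: "(real \<Rightarrow> 'a::metric_space) \<Rightarrow> real \<Rightarrow> bool" where
  "unit_speed \<gamma> l \<longleftrightarrow> 0 \<le> l \<and> (\<forall>a b. 0 \<le> a \<longrightarrow> a \<le> b \<longrightarrow> b \<le> l \<longrightarrow> geodesic_chain \<gamma> a b)"

lemma partition_mono:
  fixes t :: "nat \<Rightarrow> real"
  assumes "\<forall>i<k. t i \<le> t (Suc i)" "i \<le> j" "j \<le> k"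
  shows "t i \<le> t j"
  using assms(2,3)
proof (induction j rule: dec_induct)
  case (step j)
  then show ?case using assms(1) by (meson Suc_le_eq less_imp_le order_trans)
qed simp

text \<open>Chains make the curve 1-Lipschitz, which bounds every partition sum; the corner points
  of a chain form a partition that attains the bound.\<close>

lemma unit_speed_imp_arclength_param:
  assumes "unit_speed \<gamma> l"
  shows "arclength_param \<gamma> l"
  unfolding arclength_param_def
proof (intro conjI allI impI)
  show "0 \<le> l" using assms by (simp add: unit_speed_def)
  fix a b :: real assume ab: "0 \<le> a \<and> a \<le> b \<and> b \<le> l"
  show "curve_length \<gamma> a b = ereal (b - a)"
  proof (rule antisym)
    show "curve_length \<gamma> a b \<le> ereal (b - a)"
      unfolding curve_length_def
    proof (rule SUP_least, clarsimp)
      fix t k assume t: "a = t (0::nat)" "b = t k" "\<forall>i<k. t i \<le> t (Suc i)"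
      have "(\<Sum>i<k. dist (\<gamma> (t i)) (\<gamma> (t (Suc i)))) \<le> (\<Sum>i<k. t (Suc i) - t i)"
      proof (rule sum_mono)
        fix i assume i: "i \<in> {..<k}"
        have "t 0 \<le> t i" "t i \<le> t (Suc i)" "t (Suc i) \<le> t k"
          using i by (auto intro!: partition_mono[OF t(3)])
        then have "geodesic_chain \<gamma> (t i) (t (Suc i))"
          using assms ab t unfolding unit_speed_def by auto
        then show "dist (\<gamma> (t i)) (\<gamma> (t (Suc i))) \<le> t (Suc i) - t i"
          by (rule geodesic_chain_dist_le)
      qed
      also have "\<dots> = t k - t 0" by (rule sum_lessThan_telescope)
      finally show "(\<Sum>i<k. dist (\<gamma> (t i)) (\<gamma> (t (Suc i)))) \<le> t k - t 0" .
    qed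
    have "geodesic_chain \<gamma> a b" using assms ab by (auto simp: unit_speed_def)
    from geodesic_chain_partition[OF this]
    obtain t k where t: "t (0::nat) = a" "t k = b" "\<forall>i<k. t i \<le> t (Suc i)"
      "(\<Sum>i<k. dist (\<gamma> (t i)) (\<gamma> (t (Suc i)))) = b - a" by blast
    show "ereal (b - a) \<le> curve_length \<gamma> a b"
      unfolding curve_length_def
      by (rule SUP_upper2[of "(t, k)"]) (use t in auto)
  qed
qed

lemma unit_speed_continuous_on:
  assumes "unit_speed \<gamma> l"
  shows "continuous_on {0..l} \<gamma>"
proof (rule continuous_on_iff[THEN iffD2], intro ballI allI impI)
  fix x e :: real assume x: "x \<in> {0..l}" and e: "0 < e"
  have "dist (\<gamma> y) (\<gamma> x) \<le> dist y x" if y: "y \<in> {0..l}" for y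
  proof (cases "x \<le> y")
    case True
    then show ?thesis using assms x y geodesic_chain_dist_le[of \<gamma> x y]
      by (auto simp: unit_speed_def dist_real_def dist_commute)
  next
    case False
    then show ?thesis using assms x y geodesic_chain_dist_le[of \<gamma> y x]
      by (auto simp: unit_speed_def dist_real_def)
  qed
  then show "\<exists>d>0. \<forall>x'\<in>{0..l}. dist x' x < d \<longrightarrow> dist (\<gamma> x') (\<gamma> x) < e"
    using e by (meson le_less_trans)
qed

text \<open>For \<open>x = \<gamma> 0\<close> the quotient is 0 by the convention on division by
  zero, and the curve is unchanged for t >= 0.\<close>

definition prepend_segment :: "'a::real_normed_vector \<Rightarrow> (real \<Rightarrow> 'a) \<Rightarrow> real \<Rightarrow> 'a" where
  "prepend_segment x \<gamma> t = (let d = dist x (\<gamma> 0) in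
     if t \<le> d then x + (t / d) *\<^sub>R (\<gamma> 0 - x) else \<gamma> (t - d))"

lemma prepend_segment_before:
  "t \<le> dist x (\<gamma> 0) \<Longrightarrow> prepend_segment x \<gamma> t = x + (t / dist x (\<gamma> 0)) *\<^sub>R (\<gamma> 0 - x)"
  by (simp add: prepend_segment_def)

lemma prepend_segment_after:
  "dist x (\<gamma> 0) \<le> t \<Longrightarrow> prepend_segment x \<gamma> t = \<gamma> (t - dist x (\<gamma> 0))"
  by (cases "t = dist x (\<gamma> 0)") (auto simp: prepend_segment_def Let_def)

lemma unit_speed_prepend_segment:
  assumes "unit_speed \<gamma> l"
  shows "unit_speed (prepend_segment x \<gamma>) (dist x (\<gamma> 0) + l)"
proof -
  define d where "d = dist x (\<gamma> 0)"
  let ?\<gamma> = "prepend_segment x \<gamma>"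
  have l: "0 \<le> l" using assms by (simp add: unit_speed_def)
  have before: "geodesic_chain ?\<gamma> a b" if "0 \<le> a" "a \<le> b" "b \<le> d" for a b
  proof (cases "d = 0")
    case True
    then have "b = a" using that by simp
    then show ?thesis by (simp add: geodesic_chain.refl)
  next
    case False
    then have "d > 0" by (simp add: d_def)
    have "?\<gamma> a - ?\<gamma> b = ((a - b) / d) *\<^sub>R (\<gamma> 0 - x)"
      using that by (simp add: prepend_segment_before d_def scaleR_diff_left diff_divide_distrib)
    then have "dist (?\<gamma> a) (?\<gamma> b) = b - a"
      using \<open>d > 0\<close> that by (simp add: dist_norm d_def norm_minus_commute)
    then show ?thesis using geodesic_chain.step[OF geodesic_chain.refl, of a b ?\<gamma>] that by simp
  qed
  have shift: "geodesic_chain ?\<gamma> (a + d) (b + d)" if "geodesic_chain \<gamma> a b" "0 \<le> a" for a b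
  proof -
    \<comment> \<open>The inequality is carried along so that all intermediate parameters, once
      shifted, lie beyond the prepended segment.\<close>
    have "a \<le> b \<and> geodesic_chain ?\<gamma> (a + d) (b + d)" using that
    proof (induction rule: geodesic_chain.induct)
      case (step a c b)
      then have "dist (?\<gamma> (c + d)) (?\<gamma> (b + d)) = b + d - (c + d)"
        by (simp add: prepend_segment_after d_def)
      then show ?case using step by (auto intro: geodesic_chain.step)
    qed (auto intro: geodesic_chain.refl)
    then show ?thesis by simp
  qed
  have after: "geodesic_chain ?\<gamma> a b" if "d \<le> a" "a \<le> b" "b \<le> d + l" for a b
    using shift[of "a - d" "b - d"] that assms by (auto simp: unit_speed_def)
  have "geodesic_chain ?\<gamma> a b" if "0 \<le> a" "a \<le> b" "b \<le> d + l" for a b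
    using before[of a b] after[of a b] before[of a d] after[of d b] that
      geodesic_chain_trans[of ?\<gamma> d b a] by linarith
  then show ?thesis using l by (auto simp: unit_speed_def d_def)
qed

text \<open>The offset \<open>A\<close> lets estimates survive when a segment of length at most \<open>A - A'\<close> is
  prepended: they then hold with offset \<open>A'\<close>.\<close>
definition john_reach :: "'a::euclidean_space set \<Rightarrow> 'a \<Rightarrow> real \<Rightarrow> real \<Rightarrow> real \<Rightarrow> real \<Rightarrow> 'a \<Rightarrow> bool" where
  "john_reach G x0 s c L A x \<longleftrightarrow> (\<exists>\<gamma> l. unit_speed \<gamma> l \<and> l \<le> L \<and> \<gamma> 0 = x \<and> \<gamma> l = x0 \<and>
     (\<forall>t\<in>{0..l}. ball (\<gamma> t) (c * (t + A) powr s) \<subseteq> G))"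

lemma john_reach_refl:
  assumes "ball x (c * A powr s) \<subseteq> G" "0 \<le> L"
  shows "john_reach G x s c L A x"
  unfolding john_reach_def using assms
  by (intro exI[of _ "\<lambda>_. x"] exI[of _ 0])
    (auto simp: unit_speed_def order_antisym_conv intro: geodesic_chain.refl)

lemma john_reach_prepend:
  assumes reach: "john_reach G x0 s c L A y"
    and "0 \<le> c" "0 \<le> s" "0 \<le> A'" "dist x y + A' \<le> A" "L + dist x y \<le> L'"
    and seg: "\<And>t. 0 \<le> t \<Longrightarrow> t \<le> dist x y \<Longrightarrow>
      ball (x + (t / dist x y) *\<^sub>R (y - x)) (c * (t + A') powr s) \<subseteq> G"
  shows "john_reach G x0 s c L' A' x"
proof -
  from reach obtain \<gamma> l where \<gamma>: "unit_speed \<gamma> l" "l \<le> L" "\<gamma> 0 = y" "\<gamma> l = x0"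
    "\<forall>t\<in>{0..l}. ball (\<gamma> t) (c * (t + A) powr s) \<subseteq> G" unfolding john_reach_def by blast
  let ?d = "dist x y"
  have l: "0 \<le> l" using \<gamma> by (simp add: unit_speed_def)
  have "ball (prepend_segment x \<gamma> t) (c * (t + A') powr s) \<subseteq> G" if t: "t \<in> {0..?d + l}" for t
  proof (cases "t \<le> ?d")
    case True
    then show ?thesis using t seg[of t] \<gamma> by (simp add: prepend_segment_before)
  next
    case False
    have "c * (t + A') powr s \<le> c * (t - ?d + A) powr s"
      using assms t by (intro mult_left_mono powr_mono2) auto
    moreover have "ball (\<gamma> (t - ?d)) (c * (t - ?d + A) powr s) \<subseteq> G"
      using \<gamma>(5) t False by auto
    ultimately show ?thesis using False \<gamma>(3) subset_ball
      by (fastforce simp: prepend_segment_after)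
  qed
  moreover have "unit_speed (prepend_segment x \<gamma>) (?d + l)"
    using unit_speed_prepend_segment[OF \<gamma>(1), of x] \<gamma>(3) by simp
  moreover have "prepend_segment x \<gamma> 0 = x"
    using \<gamma>(3) by (simp add: prepend_segment_before)
  moreover have "prepend_segment x \<gamma> (?d + l) = x0"
    using \<gamma>(3,4) l by (simp add: prepend_segment_after)
  ultimately show ?thesis unfolding john_reach_def using assms \<gamma>(2)
    by (intro exI[of _ "prepend_segment x \<gamma>"] exI[of _ "?d + l"]) auto
qed

text \<open>The homothety with centre x and ratio u maps the ball around y onto the smaller ball and
  keeps B inside itself.\<close>

lemma convex_ball_towards:
  fixes x y :: "'a::real_normed_vector"
  assumes B: "convex B" "x \<in> B" "ball y r \<subseteq> B" and u: "0 \<le> u" "u \<le> 1"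
  shows "ball (x + u *\<^sub>R (y - x)) (u * r) \<subseteq> B"
proof
  fix z assume z: "z \<in> ball (x + u *\<^sub>R (y - x)) (u * r)"
  have "u > 0" using z u by (cases "u = 0") auto
  define v where "v = y + (1 / u) *\<^sub>R (z - (x + u *\<^sub>R (y - x)))"
  have "norm (z - (x + u *\<^sub>R (y - x))) < u * r"
    using z by (simp add: dist_norm norm_minus_commute)
  then have "norm (z - (x + u *\<^sub>R (y - x))) / u < r"
    using \<open>u > 0\<close> by (simp add: field_simps)
  then have "v \<in> ball y r"
    using \<open>u > 0\<close> by (simp add: v_def dist_norm)
  then have "v \<in> B" using B by blast
  moreover have "z = (1 - u) *\<^sub>R x + u *\<^sub>R v"
    using \<open>u > 0\<close> by (simp add: v_def algebra_simps)
  ultimately show "z \<in> B" using B u by (auto simp: convex_def)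
qed

text \<open>For each offset v of norm less than r, B contains the parallel segment from
  \<open>x + v\<close> to \<open>y + v\<close>.\<close>

lemma convex_ball_between:
  fixes x y :: "'a::real_normed_vector"
  assumes B: "convex B" "ball x r \<subseteq> B" "ball y r \<subseteq> B" and u: "0 \<le> u" "u \<le> 1"
  shows "ball (x + u *\<^sub>R (y - x)) r \<subseteq> B"
proof
  fix z assume z: "z \<in> ball (x + u *\<^sub>R (y - x)) r"
  define v where "v = z - (x + u *\<^sub>R (y - x))"
  have "norm v < r" using z by (simp add: v_def dist_norm norm_minus_commute)
  then have "x + v \<in> B" "y + v \<in> B" using B by (auto simp: dist_norm subset_iff)
  then have "(1 - u) *\<^sub>R (x + v) + u *\<^sub>R (y + v) \<in> B" using B u by (auto simp: convex_def)
  also have "(1 - u) *\<^sub>R (x + v) + u *\<^sub>R (y + v) = z" by (simp add: v_def algebra_simps)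
  finally show "z \<in> B" .
qed

lemma john_reach_prepend_corridor:
  assumes "john_reach G x0 s c L A y" and "0 \<le> c" "0 \<le> s" "0 \<le> A'"
    and "dist x y + A' \<le> A" "L + dist x y \<le> L'"
    and B: "convex B" "B \<subseteq> G" "ball x r \<subseteq> B" "ball y r \<subseteq> B" and r: "c * A powr s \<le> r"
  shows "john_reach G x0 s c L' A' x"
proof (rule john_reach_prepend[OF assms(1-6)])
  fix t assume t: "0 \<le> t" "t \<le> dist x y"
  have "c * (t + A') powr s \<le> c * A powr s"
    using assms t by (intro mult_left_mono powr_mono2) auto
  then have "ball (x + (t / dist x y) *\<^sub>R (y - x)) (c * (t + A') powr s)
      \<subseteq> ball (x + (t / dist x y) *\<^sub>R (y - x)) r" using r by (intro subset_ball) auto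
  also have "\<dots> \<subseteq> B" using t by (intro convex_ball_between B) (auto simp: divide_le_eq_1)
  finally show "ball (x + (t / dist x y) *\<^sub>R (y - x)) (c * (t + A') powr s) \<subseteq> G" using B by blast
qed

text \<open>Serves for starting points arbitrarily close to the boundary. On the way to y the
  available radius grows linearly, as in a cone, and because \<open>s \<ge> 1\<close> the power
  \<open>t powr s\<close> stays below the linear function that agrees with it at the end of the
  segment.\<close>

lemma john_reach_prepend_convex:
  assumes "john_reach G x0 s c L A y" and "0 \<le> c" "1 \<le> s"
    and "dist x y \<le> A" "L + dist x y \<le> L'"
    and B: "convex B" "B \<subseteq> G" "x \<in> B" "ball y r \<subseteq> B" and r: "c * A powr s \<le> r"
  shows "john_reach G x0 s c L' 0 x"
proof (rule john_reach_prepend[OF assms(1,2) _ _ _ assms(5)])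
  fix t assume t: "0 \<le> t" "t \<le> dist x y"
  let ?d = "dist x y"
  have "c * (t + 0) powr s \<le> (t / ?d) * r"
  proof (cases "t = 0")
    case False
    then have d: "0 < t" "0 < ?d" using t by auto
    have "t powr s = t * t powr (s - 1)" using d by (simp add: powr_diff)
    also have "\<dots> \<le> t * ?d powr (s - 1)" using t assms d by (intro mult_left_mono powr_mono2) auto
    also have "\<dots> = (t / ?d) * ?d powr s" using d by (simp add: powr_diff)
    also have "\<dots> \<le> (t / ?d) * A powr s" using assms d by (intro mult_left_mono powr_mono2) auto
    finally have "c * t powr s \<le> c * ((t / ?d) * A powr s)" using assms by (intro mult_left_mono) auto
    also have "\<dots> = (t / ?d) * (c * A powr s)" by simp
    also have "\<dots> \<le> (t / ?d) * r" using r d by (intro mult_left_mono) auto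
    finally show ?thesis by simp
  qed simp
  then have "ball (x + (t / ?d) *\<^sub>R (y - x)) (c * (t + 0) powr s)
      \<subseteq> ball (x + (t / ?d) *\<^sub>R (y - x)) ((t / ?d) * r)" by (intro subset_ball) auto
  also have "\<dots> \<subseteq> B" using t by (intro convex_ball_towards B) (auto simp: divide_le_eq_1)
  finally show "ball (x + (t / ?d) *\<^sub>R (y - x)) (c * (t + 0) powr s) \<subseteq> G" using B by blast
qed (use assms in auto)

lemma ball_subset_imp_infdist_frontier:
  fixes x :: "'a::euclidean_space"
  assumes "x \<in> G" "ball x r \<subseteq> G" "open G" "frontier G \<noteq> {}"
  shows "r \<le> infdist x (frontier G)"
proof -
  have "r \<le> dist x z" if "z \<in> frontier G" for z
  proof -
    have "z \<notin> G" using that assms by (auto simp: frontier_def interior_open)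
    then show ?thesis using assms(2) by (auto simp: subset_iff not_less)
  qed
  then show ?thesis using assms(4) by (simp add: infdist_def cINF_greatest)
qed

text \<open>The curves also provide the connectedness. Boundedness makes the frontier nonempty,
  which matters because \<open>infdist\<close> to the empty set is 0.\<close>

lemma john_domainI:
  fixes G :: "'a::euclidean_space set"
  assumes "1 \<le> s" "bounded G" "open G" "x0 \<in> G" "0 < c"
    and reach: "\<And>x. x \<in> G \<Longrightarrow> john_reach G x0 s c L 0 x"
  shows "john_domain s G"
proof -
  have fr: "frontier G \<noteq> {}"
    using assms by (auto simp: frontier_eq_empty)
  \<comment> \<open>One constant has to bound the lengths and at the same time absorb the factor c
    of the distance estimate.\<close>
  define C where "C = max (max L (1 / c)) 1"
  have C: "C > 0" "L \<le> C" "1 / c \<le> C" by (auto simp: C_def)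
  then have C3: "1 / C \<le> c" using \<open>0 < c\<close> by (simp add: field_simps)
  have *: "\<exists>\<gamma> l. unit_speed \<gamma> l \<and> l \<le> C \<and> \<gamma> 0 = x \<and> \<gamma> l = x0 \<and> \<gamma> ` {0..l} \<subseteq> G \<and>
        (\<forall>t\<in>{0..l}. infdist (\<gamma> t) (frontier G) \<ge> t powr s / C)" if x: "x \<in> G" for x
  proof -
    from reach[OF x] obtain \<gamma> l where \<gamma>: "unit_speed \<gamma> l" "l \<le> L" "\<gamma> 0 = x" "\<gamma> l = x0"
      "\<forall>t\<in>{0..l}. ball (\<gamma> t) (c * t powr s) \<subseteq> G" unfolding john_reach_def by auto
    \<comment> \<open>At t = 0 the ball has radius 0 and is empty, so the starting point is treated
      separately.\<close>
    have G: "\<gamma> t \<in> G" if "t \<in> {0..l}" for t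
    proof (cases "t = 0")
      case False
      then have "\<gamma> t \<in> ball (\<gamma> t) (c * t powr s)" using \<open>0 < c\<close> that by simp
      then show ?thesis using \<gamma> that by blast
    qed (use \<gamma> x in simp)
    have "t powr s / C \<le> infdist (\<gamma> t) (frontier G)" if t: "t \<in> {0..l}" for t
    proof -
      have "t powr s / C \<le> c * t powr s" using C3 mult_right_mono[of "1 / C" c "t powr s"] by simp
      also have "\<dots> \<le> infdist (\<gamma> t) (frontier G)"
        using G[OF t] \<gamma>(5) t assms fr by (intro ball_subset_imp_infdist_frontier) auto
      finally show ?thesis .
    qed
    then show ?thesis using \<gamma> G C by (intro exI[of _ \<gamma>] exI[of _ l]) auto
  qed
  have "connected_component G x0 x" if x: "x \<in> G" for x
  proof -
    obtain \<gamma> l where \<gamma>: "unit_speed \<gamma> l" "\<gamma> 0 = x" "\<gamma> l = x0" "\<gamma> ` {0..l} \<subseteq> G"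
      using *[OF x] by blast
    have "connected (\<gamma> ` {0..l})"
      using unit_speed_continuous_on[OF \<gamma>(1)] by (intro connected_continuous_image) auto
    moreover have "0 \<le> l" using \<gamma> by (simp add: unit_speed_def)
    ultimately show ?thesis unfolding connected_component_def
      using \<gamma> by (intro exI[of _ "\<gamma> ` {0..l}"]) (auto intro: image_eqI[of _ _ 0] image_eqI[of _ _ l])
  qed
  then have "connected G"
    by (metis connected_iff_connected_component connected_component_sym connected_component_trans)
  then show ?thesis unfolding john_domain_def
  proof (intro conjI bexI[of _ x0] exI[of _ C] ballI)
    fix x assume "x \<in> G"
    from *[OF this] obtain \<gamma> l where "unit_speed \<gamma> l" "l \<le> C \<and> \<gamma> 0 = x \<and> \<gamma> l = x0 \<and>
        \<gamma> ` {0..l} \<subseteq> G \<and> (\<forall>t\<in>{0..l}. infdist (\<gamma> t) (frontier G) \<ge> t powr s / C)" by blast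
    then show "\<exists>\<gamma> l. arclength_param \<gamma> l \<and> l \<le> C \<and> \<gamma> 0 = x \<and> \<gamma> l = x0 \<and>
        \<gamma> ` {0..l} \<subseteq> G \<and> (\<forall>t\<in>{0..l}. infdist (\<gamma> t) (frontier G) \<ge> t powr s / C)"
      using unit_speed_imp_arclength_param by blast
  qed (use assms C in auto)
qed

section \<open>The tree of bars, tubes and rooms\<close>

definition obox :: "real ^ 'n \<Rightarrow> ('n \<Rightarrow> real) \<Rightarrow> (real ^ 'n) set" where
  "obox c h = {x. \<forall>l. \<bar>x $ l - c $ l\<bar> < h l}"

definition kbox :: "real ^ 'n \<Rightarrow> ('n \<Rightarrow> real) \<Rightarrow> (real ^ 'n) set" where
  "kbox c h = {x. \<forall>l. \<bar>x $ l - c $ l\<bar> \<le> h l}"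

lemma oboxD: "x \<in> obox c h \<Longrightarrow> \<bar>x $ l - c $ l\<bar> < h l"
  and kboxD: "x \<in> kbox c h \<Longrightarrow> \<bar>x $ l - c $ l\<bar> \<le> h l"
  by (simp_all add: obox_def kbox_def)

lemma obox_eq_box: "obox c h = box (c - (\<chi> l. h l)) (c + (\<chi> l. h l))"
  by (auto simp: obox_def mem_box_cart abs_less_iff algebra_simps)

lemma kbox_eq_cbox: "kbox c h = cbox (c - (\<chi> l. h l)) (c + (\<chi> l. h l))"
  by (auto simp: kbox_def mem_box_cart abs_le_iff algebra_simps)

lemma open_obox [simp]: "open (obox c h)" and convex_obox [simp]: "convex (obox c h)"
  by (simp_all add: obox_eq_box open_box convex_box)

lemma closed_kbox [simp]: "closed (kbox c h)" and bounded_kbox [simp]: "bounded (kbox c h)"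
  by (simp_all add: kbox_eq_cbox closed_cbox)

lemma frontier_obox_subset: "frontier (obox c h) \<subseteq> kbox c h - obox c h"
proof -
  have "closure (obox c h) \<subseteq> kbox c h"
    by (rule closure_minimal[OF _ closed_kbox]) (auto simp: obox_def kbox_def less_imp_le)
  then show ?thesis by (auto simp: frontier_def interior_open)
qed

lemma frontier_kbox_subset: "frontier (kbox c h) \<subseteq> kbox c h - obox c h"
proof -
  have "obox c h \<subseteq> interior (kbox c h)"
    by (rule interior_maximal[OF _ open_obox]) (auto simp: obox_def kbox_def less_imp_le)
  then show ?thesis by (auto simp: frontier_def)
qed

lemma ball_subset_obox:
  assumes "\<And>l. \<bar>x $ l - c $ l\<bar> + r \<le> h l"
  shows "ball x r \<subseteq> obox c h"
proof
  fix z assume "z \<in> ball x r"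
  then have "norm (z - x) < r" by (simp add: dist_norm norm_minus_commute)
  show "z \<in> obox c h" unfolding obox_def
  proof (clarify)
    fix l
    have "\<bar>(z - x) $ l\<bar> \<le> norm (z - x)" by (rule component_le_norm_cart)
    with \<open>norm (z - x) < r\<close> assms[of l] show "\<bar>z $ l - c $ l\<bar> < h l" by simp
  qed
qed

lemma dist_le_CARD_mult:
  fixes x y :: "real ^ 'n"
  assumes "\<And>l. \<bar>x $ l - y $ l\<bar> \<le> d"
  shows "dist x y \<le> real CARD('n) * d"
proof -
  have "dist x y \<le> (\<Sum>l\<in>UNIV. \<bar>(x - y) $ l\<bar>)"
    unfolding dist_norm by (rule norm_le_l1_cart)
  also have "\<dots> \<le> (\<Sum>l\<in>(UNIV :: 'n set). d)" using assms by (intro sum_mono) simp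
  finally show ?thesis by simp
qed

section \<open>Scales and axes of the tree\<close>

locale room_tree =
  fixes idx :: "'n::finite \<Rightarrow> nat" and \<kappa> s :: real
  assumes idx: "bij_betw idx UNIV {..<CARD('n)}"
    and card2: "2 \<le> CARD('n)"
    and kappa: "0 < \<kappa>" "\<kappa> < 1" "\<kappa> ^ CARD('n) < 1 / 2"
    and s1: "1 \<le> s"
begin

definition q :: real where "q = \<kappa> ^ CARD('n)"
text \<open>Chosen so that \<open>2 * g + 2 * q = 1\<close>. In units of \<open>\<kappa> ^ k\<close>
  a child is centred at distance 1 from its parent and its cell reaches back by
  \<open>2 * q\<close>. A gap of \<open>2 * g\<close> remains on either side of the parent's centre;
  the tube and the room are placed at its middle, \<open>g\<close>.\<close>

definition g :: real where "g = (1 - 2 * q) / 2"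
text \<open>Small against the gap, against the cells and, through the factor \<kappa>, against the
  gap of the next level. The denominator 10 leaves space for the small multiples of
  \<open>E k\<close> that occur as heights and widths.\<close>

definition \<epsilon> :: real where "\<epsilon> = \<kappa> * g * q / 10"
definition W :: "nat \<Rightarrow> real" where "W k = \<epsilon> * (\<kappa> ^ k) powr s"

lemma q_pos: "0 < q" and q_half: "q < 1 / 2" and g_pos: "0 < g" and g_half: "g \<le> 1 / 2"
  using kappa by (auto simp: q_def g_def)

lemma eps_pos: "0 < \<epsilon>"
  using q_pos g_pos kappa by (simp add: \<epsilon>_def)

lemma eps_kappa_g: "10 * \<epsilon> \<le> \<kappa> * g" and eps_q: "10 * \<epsilon> \<le> q" and eps_g: "10 * \<epsilon> \<le> g"
proof -
  have *: "10 * \<epsilon> = \<kappa> * g * q" by (simp add: \<epsilon>_def)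
  show "10 * \<epsilon> \<le> \<kappa> * g"
    unfolding * using q_pos q_half g_pos kappa by (intro mult_left_le) auto
  show "10 * \<epsilon> \<le> q"
    unfolding * using q_pos g_half g_pos kappa
    by (intro mult_left_le_one_le mult_le_one) auto
  show "10 * \<epsilon> \<le> g"
    using \<open>10 * \<epsilon> \<le> \<kappa> * g\<close> mult_left_le_one_le[of g \<kappa>] g_pos kappa by linarith
qed

lemma kpow_pos: "0 < \<kappa> ^ k" and kpow_le_1: "\<kappa> ^ k \<le> 1"
  using kappa by (auto intro: power_le_one)

lemma W_pos: "0 < W k"
  using eps_pos kappa by (simp add: W_def)

lemma W_le: "W k \<le> \<epsilon> * \<kappa> ^ k"
proof -
  have "(\<kappa> ^ k) powr s \<le> (\<kappa> ^ k) powr 1"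
    using s1 kpow_pos[of k] kpow_le_1[of k] by (intro powr_mono') auto
  then show ?thesis unfolding W_def using eps_pos kpow_pos[of k] by (intro mult_left_mono) auto
qed

definition E where "E k = \<epsilon> * \<kappa> ^ k"
definition D where "D k = g * \<kappa> ^ k"
definition Q where "Q k = q * \<kappa> ^ k"

lemma scaled:
  "0 < E k" "10 * E k \<le> D k" "10 * E k \<le> Q k" "10 * E k \<le> D (Suc k)" "0 < D k" "0 < Q k"
  "2 * D k + 2 * Q k = \<kappa> ^ k" "0 < W k" "W k \<le> E k" "E (Suc k) \<le> E k"
proof -
  show "10 * E k \<le> D (Suc k)"
    using mult_right_mono[OF eps_kappa_g, of "\<kappa> ^ k"] kpow_pos[of k]
    by (simp add: E_def D_def mult_ac)
  have "2 * D k + 2 * Q k = (2 * g + 2 * q) * \<kappa> ^ k" by (simp add: D_def Q_def algebra_simps)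
  also have "2 * g + 2 * q = 1" by (simp add: g_def field_simps)
  finally show "2 * D k + 2 * Q k = \<kappa> ^ k" by simp
  show "E (Suc k) \<le> E k" using kappa eps_pos kpow_pos[of k] by (simp add: E_def)
qed (use eps_pos kpow_pos[of k] eps_g eps_q q_pos g_pos W_pos W_le in \<open>auto simp: E_def D_def Q_def\<close>)

definition ax :: "nat \<Rightarrow> 'n" where "ax k = the_inv idx (k mod CARD('n))"

lemma idx_less: "idx l < CARD('n)"
  using idx by (auto simp: bij_betw_def)

lemma idx_ax: "idx (ax k) = k mod CARD('n)"
  unfolding ax_def using idx card2
  by (intro f_the_inv_into_f) (auto simp: bij_betw_def)

lemma ax_eq_iff: "l = ax k \<longleftrightarrow> idx l = k mod CARD('n)"
  using idx_ax idx by (metis UNIV_I bij_betw_def inj_on_def)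

lemma ax_Suc_neq: "ax (Suc k) \<noteq> ax k"
  using card2 by (auto simp: ax_eq_iff idx_ax mod_Suc split: if_splits)

text \<open>The number of levels after \<open>k\<close> until the coordinate \<open>l\<close> is used next.\<close>
definition delay :: "nat \<Rightarrow> 'n \<Rightarrow> nat" where
  "delay k l = nat ((int (idx l) - int k) mod int CARD('n))"

text \<open>Half-widths of cells. The moves along axis \<open>l\<close> from level k on have sizes
  \<open>\<kappa> ^ (k + delay k l)\<close> times powers of \<open>q\<close>; as
  \<open>q < 1 / 2\<close>, their sum is below twice the first one.\<close>

definition H :: "nat \<Rightarrow> 'n \<Rightarrow> real" where "H k l = 2 * \<kappa> ^ (k + delay k l)"

lemma delay_less: "delay k l < CARD('n)"
  using card2 by (simp add: delay_def nat_less_iff)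

lemma delay_ax: "delay k (ax k) = 0"
  by (simp add: delay_def idx_ax zmod_int mod_diff_left_eq)

lemma delay_Suc:
  "delay (Suc k) l = (if l = ax k then CARD('n) - 1 else delay k l - 1)"
  "l \<noteq> ax k \<Longrightarrow> 0 < delay k l"
proof -
  let ?N = "int CARD('n)" and ?a = "int (idx l) - int k"
  have N: "2 \<le> ?N" using card2 by linarith
  have zero: "l = ax k \<longleftrightarrow> ?a mod ?N = 0"
  proof -
    have "?a mod ?N = 0 \<longleftrightarrow> int (idx l) mod ?N = int k mod ?N"
      by (simp add: mod_eq_dvd_iff dvd_eq_mod_eq_0)
    also have "\<dots> \<longleftrightarrow> idx l = k mod CARD('n)"
      using idx_less[of l] by (metis mod_less of_nat_eq_iff zmod_int)
    finally show ?thesis by (simp add: ax_eq_iff)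
  qed
  have "(?a - 1) mod ?N = (if ?a mod ?N = 0 then ?N - 1 else ?a mod ?N - 1)"
  proof -
    have r: "0 \<le> ?a mod ?N" "?a mod ?N < ?N" using N by auto
    have "(?a - 1) mod ?N = (?a mod ?N - 1) mod ?N" by (simp add: mod_diff_left_eq)
    also have "\<dots> = (if ?a mod ?N = 0 then ?N - 1 else ?a mod ?N - 1)"
    proof (cases "?a mod ?N = 0")
      case True
      then show ?thesis using N by (simp add: zmod_minus1)
    next
      case False
      then have "0 \<le> ?a mod ?N - 1" "?a mod ?N - 1 < ?N" using r by linarith+
      then have "(?a mod ?N - 1) mod ?N = ?a mod ?N - 1" by (rule mod_pos_pos_trivial)
      then show ?thesis using False by simp
    qed
    finally show ?thesis .
  qed
  moreover have "int (idx l) - int (Suc k) = ?a - 1" by simp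
  ultimately have "(int (idx l) - int (Suc k)) mod ?N = (if ?a mod ?N = 0 then ?N - 1 else ?a mod ?N - 1)"
    by metis
  then show "delay (Suc k) l = (if l = ax k then CARD('n) - 1 else delay k l - 1)"
    unfolding delay_def zero by (simp del: of_nat_Suc add: nat_diff_distrib')
  show "0 < delay k l" if "l \<noteq> ax k"
    using that zero N by (simp add: delay_def order.not_eq_order_implies_strict)
qed

lemma H_ax: "H k (ax k) = 2 * \<kappa> ^ k"
  by (simp add: H_def delay_ax)

lemma H_Suc_ax: "H (Suc k) (ax k) = 2 * Q k"
proof -
  have "Suc k + (CARD('n) - 1) = CARD('n) + k" using card2 by simp
  then show ?thesis unfolding H_def delay_Suc Q_def q_def by (simp add: power_add)
qed

lemma H_Suc: "l \<noteq> ax k \<Longrightarrow> H (Suc k) l = H k l"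
  using delay_Suc[where k = k and l = l] by (simp add: H_def)

lemma H_ge: "2 * Q k \<le> H k l"
proof -
  have "\<kappa> ^ (k + CARD('n)) \<le> \<kappa> ^ (k + delay k l)"
    using kappa delay_less[of k l] by (intro power_decreasing) auto
  then show ?thesis by (simp add: H_def Q_def q_def power_add mult_ac)
qed

lemma H_le: "H k l \<le> 2 * \<kappa> ^ k"
  using kappa by (simp add: H_def power_decreasing)

text \<open>Words grow at the head: \<open>a # w\<close> is a child of \<open>w\<close>,
  \<open>v @ w\<close> a descendant, and the length is the level.\<close>

fun p :: "bool list \<Rightarrow> real ^ 'n" where
  "p [] = 0"
| "p (a # w) = p w + ((if a then 1 else - 1) * \<kappa> ^ length w) *\<^sub>R axis (ax (length w)) 1"

lemma p_Cons_nth: "p (a # w) $ l =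
    p w $ l + (if l = ax (length w) then (if a then 1 else - 1) * \<kappa> ^ length w else 0)"
  by (auto simp: axis_def)

declare p.simps(2) [simp del]

definition anchor :: "bool list \<Rightarrow> real ^ 'n" where
  "anchor w = p w + (D (length w)) *\<^sub>R axis (ax (length w)) 1"

text \<open>Height over the bar's axis, measured along the next axis in units of \<open>E\<close>.
  The bar reaches up to height 1, the room fills heights 3 to 5, and the tube joins heights 0 and 4,
  with an excess of \<open>W\<close> at both ends. Only its part between 1 and 3 is outside bar and
  room.\<close>

definition above :: "bool list \<Rightarrow> real \<Rightarrow> real ^ 'n" where
  "above w t = anchor w + (t * (E (length w))) *\<^sub>R axis (ax (Suc (length w))) 1"

lemma anchor_nth: "anchor w $ l = p w $ l + (if l = ax (length w) then D (length w) else 0)"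
  by (auto simp: anchor_def axis_def)

lemma above_nth: "above w t $ l = p w $ l + (if l = ax (length w) then D (length w)
    else if l = ax (Suc (length w)) then t * (E (length w)) else 0)"
  using ax_Suc_neq[of "length w"] by (auto simp: above_def anchor_nth axis_def)

definition bar where "bar w =
  obox (p w) (\<lambda>l. if l = ax (length w) then \<kappa> ^ length w + E (length w) else E (length w))"
definition tube where "tube w =
  obox (above w 2) (\<lambda>l. if l = ax (Suc (length w)) then 2 * (E (length w)) + W (length w)
    else W (length w))"
definition room where "room w = obox (above w 4) (\<lambda>_. E (length w))"
definition branch where "branch w = bar w \<union> tube w \<union> room w"
definition cell where "cell w = kbox (p w) (H (length w))"

text \<open>A closed box that isolates the room: it contains no point of the domain outside the room and its tube.\<close>
definition casing where "casing w =
  kbox (above w 4) (\<lambda>l. if l = ax (Suc (length w)) then 3 * E (length w)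
    else 2 * (E (length w)))"
definition G :: "(real ^ 'n) set" where "G = (\<Union>w. branch w)"

section \<open>Nesting and disjointness of the cells\<close>

lemma cell_Cons_subset: "cell (a # w) \<subseteq> cell w"
proof
  fix x assume x: "x \<in> cell (a # w)"
  show "x \<in> cell w" unfolding cell_def kbox_def
  proof clarify
    fix l
    have *: "\<bar>x $ l - p (a # w) $ l\<bar> \<le> H (Suc (length w)) l"
      using x unfolding cell_def by (auto dest: kboxD[where l = l])
    show "\<bar>x $ l - p w $ l\<bar> \<le> H (length w) l"
      using * scaled[of "length w"] q_half
      by (cases "l = ax (length w)") (auto simp: p_Cons_nth H_ax H_Suc_ax H_Suc split: if_splits)
  qed
qed

lemma cell_append_subset: "cell (v @ w) \<subseteq> cell w"
  by (induction v) (use cell_Cons_subset in auto)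

lemma cell_Cons_side:
  assumes "x \<in> cell (a # w)"
  shows "2 * (D (length w)) \<le> (if a then 1 else - 1) * (x $ ax (length w) - p w $ ax (length w))"
proof -
  have "\<bar>x $ ax (length w) - p (a # w) $ ax (length w)\<bar> \<le> H (Suc (length w)) (ax (length w))"
    using assms by (auto simp: cell_def kbox_def)
  then show ?thesis using scaled[of "length w"]
    by (auto simp: p_Cons_nth H_Suc_ax)
qed

text \<open>Siblings lie on opposite sides of their parent's gap; all other pairs inherit the
  disjointness from their parents.\<close>

lemma cell_disjoint:
  assumes "length v = length w" "v \<noteq> w"
  shows "cell v \<inter> cell w = {}"
  using assms
proof (induction v w rule: list_induct2)
  case (Cons a v b w)
  show ?case
  proof (cases "v = w")
    case True
    then have "a \<noteq> b" using Cons by auto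
    have False if "x \<in> cell (a # v)" "x \<in> cell (b # v)" for x
      using cell_Cons_side[OF that(1)] cell_Cons_side[OF that(2)] \<open>a \<noteq> b\<close> scaled(5)[of "length v"]
      by (auto split: if_splits)
    then show ?thesis using True by blast
  next
    case False
    then show ?thesis using Cons cell_Cons_subset by blast
  qed
qed simp

lemma casing_subset_cell: "casing w \<subseteq> cell w"
proof
  fix x assume x: "x \<in> casing w"
  show "x \<in> cell w" unfolding cell_def kbox_def
  proof clarify
    fix l
    have "\<bar>x $ l - above w 4 $ l\<bar> \<le> (if l = ax (Suc (length w))
        then 3 * E (length w) else 2 * (E (length w)))"
      using x unfolding casing_def by (blast dest: kboxD[where l = l])
    then show "\<bar>x $ l - p w $ l\<bar> \<le> H (length w) l"
      using scaled[of "length w"] H_ge[of "length w" l] H_ax[of "length w"] ax_Suc_neq[of "length w"]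
      unfolding above_nth by (auto split: if_splits)
  qed
qed

lemma chamber_subset_cell: "tube w \<union> room w \<subseteq> cell w"
proof
  fix x assume x: "x \<in> tube w \<union> room w"
  show "x \<in> cell w" unfolding cell_def kbox_def
  proof clarify
    fix l
    have "\<bar>x $ l - above w 2 $ l\<bar> < (if l = ax (Suc (length w)) then 2 * (E (length w)) + W (length w)
         else W (length w)) \<or> \<bar>x $ l - above w 4 $ l\<bar> < E (length w)"
      using x unfolding tube_def room_def by (blast dest: oboxD[where l = l])
    then show "\<bar>x $ l - p w $ l\<bar> \<le> H (length w) l"
      using scaled[of "length w"] H_ge[of "length w" l] H_ax[of "length w"] ax_Suc_neq[of "length w"]
      unfolding above_nth by (auto split: if_splits)
  qed
qed

lemma bar_subset_cell: "bar w \<subseteq> cell w"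
proof
  fix x assume x: "x \<in> bar w"
  show "x \<in> cell w" unfolding cell_def kbox_def
  proof clarify
    fix l
    have "\<bar>x $ l - p w $ l\<bar> < (if l = ax (length w) then \<kappa> ^ length w + E (length w) else E (length w))"
      using x unfolding bar_def by (blast dest: oboxD[where l = l])
    then show "\<bar>x $ l - p w $ l\<bar> \<le> H (length w) l"
      using scaled[of "length w"] H_ge[of "length w" l] H_ax[of "length w"]
      by (smt (verit, best))
  qed
qed

lemma branch_subset_cell: "branch w \<subseteq> cell w"
  using bar_subset_cell chamber_subset_cell by (auto simp: branch_def)

lemma bar_other: "x \<in> bar w \<Longrightarrow> l \<noteq> ax (length w) \<Longrightarrow> \<bar>x $ l - p w $ l\<bar> < E (length w)"
  unfolding bar_def by (drule oboxD[where l = l]) simp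

lemma chamber_axis:
  assumes "x \<in> tube w \<union> room w"
  shows "\<bar>x $ ax (length w) - p w $ ax (length w) - D (length w)\<bar> < E (length w)"
proof -
  have "\<bar>x $ ax (length w) - above w 2 $ ax (length w)\<bar> < W (length w) \<or>
      \<bar>x $ ax (length w) - above w 4 $ ax (length w)\<bar> < E (length w)"
    using assms ax_Suc_neq[of "length w", symmetric]
    by (auto simp: tube_def room_def dest: oboxD[where l = "ax (length w)"])
  then show ?thesis using scaled(8,9)[of "length w"]
    by (auto simp: above_nth algebra_simps)
qed

lemma casing_axis:
  assumes "x \<in> casing w"
  shows "\<bar>x $ ax (length w) - p w $ ax (length w) - D (length w)\<bar> \<le> 2 * (E (length w))"
proof -
  have "\<bar>x $ ax (length w) - above w 4 $ ax (length w)\<bar> \<le> 2 * (E (length w))"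
    using assms ax_Suc_neq[of "length w", symmetric]
    by (auto simp: casing_def dest: kboxD[where l = "ax (length w)"])
  then show ?thesis by (simp add: above_nth algebra_simps)
qed

lemma casing_side:
  assumes "x \<in> casing w"
  shows "E (length w) \<le> x $ ax (Suc (length w)) - p w $ ax (Suc (length w))"
proof -
  have "\<bar>x $ ax (Suc (length w)) - above w 4 $ ax (Suc (length w))\<bar> \<le> 3 * E (length w)"
    using assms by (auto simp: casing_def dest: kboxD[where l = "ax (Suc (length w))"])
  moreover have "above w 4 $ ax (Suc (length w))
      = p w $ ax (Suc (length w)) + 4 * E (length w)"
    using ax_Suc_neq[of "length w"] by (simp add: above_nth)
  ultimately show ?thesis by linarith
qed

section \<open>Isolation of the rooms\<close>

lemma casing_Int_bar: "casing w \<inter> bar w = {}"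
proof -
  have False if x: "x \<in> casing w" "x \<in> bar w" for x
    using casing_side[OF x(1)] bar_other[OF x(2) ax_Suc_neq] by linarith
  then show ?thesis by blast
qed

lemma split_at_level:
  assumes "n \<le> length u"
  obtains v u' where "u = v @ u'" "length u' = n"
  using assms by (metis append_take_drop_id diff_diff_cancel length_drop)

text \<open>The casing lies in a child cell of \<open>u\<close>, beyond the tube and the room of
  \<open>u\<close>, so only the bar of \<open>u\<close> could meet it. Along the child's axis this
  bar stays within \<open>E\<close> of the child's centre, whereas the casing is off by about the
  child's \<open>D\<close>, or by at least twice that if it belongs to a deeper word. That is the
  purpose of making \<open>E k\<close> small against \<open>D (Suc k)\<close>.\<close>

lemma casing_Int_branch_ancestor: "casing (v @ a # u) \<inter> branch u = {}"
proof -
  let ?w = "v @ a # u" and ?i = "ax (length u)"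
  have False if x: "x \<in> casing ?w" "x \<in> branch u" for x
  proof -
    have "x \<in> cell (a # u)" using x casing_subset_cell cell_append_subset[of v] by blast
    from cell_Cons_side[OF this] have side: "2 * (D (length u)) \<le> \<bar>x $ ?i - p u $ ?i\<bar>"
      by (auto split: if_splits)
    have "x \<notin> tube u \<union> room u"
    proof
      assume "x \<in> tube u \<union> room u"
      from chamber_axis[OF this] side scaled[of "length u"] show False by linarith
    qed
    then have bar: "x \<in> bar u" using x by (auto simp: branch_def)
    let ?i' = "ax (Suc (length u))"
    have eq: "p (a # u) $ ?i' = p u $ ?i'" using ax_Suc_neq by (simp add: p_Cons_nth)
    have small: "\<bar>x $ ?i' - p (a # u) $ ?i'\<bar> < E (length u)"
      using bar_other[OF bar, of ?i'] ax_Suc_neq eq by simp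
    show False
    proof (cases v rule: rev_cases)
      case Nil
      then have "\<bar>x $ ?i' - p (a # u) $ ?i' - D (Suc (length u))\<bar> \<le> 2 * (E (Suc (length u)))"
        using casing_axis[OF x(1)] by simp
      then show False
        using small scaled[of "length u"] by linarith
    next
      case (snoc v' a')
      then have "x \<in> cell (a' # a # u)"
        using x casing_subset_cell cell_append_subset[of v' "a' # a # u"] by auto
      from cell_Cons_side[OF this] have "2 * (D (Suc (length u))) \<le> \<bar>x $ ?i' - p (a # u) $ ?i'\<bar>"
        by (auto split: if_splits)
      then show False using small scaled[of "length u"] scaled(5)[of "Suc (length u)"] by linarith
    qed
  qed
  then show ?thesis by blast
qed

lemma casing_Int_branch_descendant: "casing u \<inter> branch (v @ a # u) = {}"
proof -
  have False if x: "x \<in> casing u" "x \<in> branch (v @ a # u)" for x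
  proof -
    have "x \<in> cell (a # u)" using x branch_subset_cell cell_append_subset[of v] by blast
    from cell_Cons_side[OF this]
    have "2 * (D (length u)) \<le> \<bar>x $ ax (length u) - p u $ ax (length u)\<bar>"
      by (auto split: if_splits)
    with casing_axis[OF x(1)] scaled[of "length u"] show False by linarith
  qed
  then show ?thesis by blast
qed

text \<open>Cut the longer word down to the length of the shorter one. Either two disjoint cells of
  that level separate the sets, or one word is a descendant of the other.\<close>

lemma casing_Int_branch:
  assumes "u \<noteq> w"
  shows "casing w \<inter> branch u = {}"
proof (cases "length w \<le> length u")
  case True
  then obtain v u' where u: "u = v @ u'" "length u' = length w" by (rule split_at_level)
  show ?thesis
  proof (cases "u' = w")
    case True
    then have "v \<noteq> []" using assms u by auto
    then obtain v' a where "v = v' @ [a]" by (metis rev_exhaust)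
    then show ?thesis using casing_Int_branch_descendant[of w v' a] u True by simp
  next
    case False
    then show ?thesis
      using cell_disjoint[OF u(2)] branch_subset_cell[of u] casing_subset_cell[of w] cell_append_subset[of v u'] u
      by blast
  qed
next
  case False
  then have "length u \<le> length w" by simp
  then obtain v w' where w: "w = v @ w'" "length w' = length u" by (rule split_at_level)
  show ?thesis
  proof (cases "w' = u")
    case True
    then have "v \<noteq> []" using assms w by auto
    then obtain v' a where "v = v' @ [a]" by (metis rev_exhaust)
    then show ?thesis using casing_Int_branch_ancestor[of v' a u] w True by simp
  next
    case False
    then show ?thesis
      using cell_disjoint[OF w(2)] branch_subset_cell[of u] casing_subset_cell[of w] cell_append_subset[of v w'] w
      by blast
  qed
qed

lemma casing_Int_G: "casing w \<inter> G \<subseteq> tube w \<union> room w"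
proof
  fix x assume x: "x \<in> casing w \<inter> G"
  then obtain u where u: "x \<in> branch u" by (auto simp: G_def)
  then have "u = w" using casing_Int_branch[of u w] x by blast
  then show "x \<in> tube w \<union> room w" using u x casing_Int_bar[of w] by (auto simp: branch_def)
qed

lemma room_subset_casing: "room w \<subseteq> casing w"
proof
  fix x assume "x \<in> room w"
  then have *: "\<bar>x $ l - above w 4 $ l\<bar> < E (length w)" for l by (auto simp: room_def obox_def)
  show "x \<in> casing w" unfolding casing_def kbox_def
  proof clarify
    fix l
    show "\<bar>x $ l - above w 4 $ l\<bar> \<le> (if l = ax (Suc (length w))
        then 3 * E (length w) else 2 * (E (length w)))"
      using *[of l] scaled(1)[of "length w"] ax_Suc_neq[of "length w"]
      by (auto simp: above_nth)
  qed
qed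

lemma branch_subset_G: "branch w \<subseteq> G" "bar w \<subseteq> G" "tube w \<subseteq> G" "room w \<subseteq> G"
  by (auto simp: G_def branch_def)

lemma open_G: "open G"
  unfolding G_def branch_def bar_def tube_def room_def by (intro open_UN ballI open_Un open_obox)

lemma G_subset_cell: "G \<subseteq> cell []"
proof
  fix x assume "x \<in> G"
  then obtain w where "x \<in> branch w" by (auto simp: G_def)
  then show "x \<in> cell []" using branch_subset_cell[of w] cell_append_subset[of w "[]"] by auto
qed

lemma bounded_G: "bounded G"
  by (rule bounded_subset[OF _ G_subset_cell]) (simp add: cell_def)

lemma p_in_bar: "p w \<in> bar w"
  using scaled[of "length w"] kpow_pos[of "length w"] by (simp add: bar_def obox_def)

end

section \<open>The John condition\<close>

context room_tree begin

lemma ball_p_subset: "ball (p w) (W (length w)) \<subseteq> bar w"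
  unfolding bar_def using scaled[of "length w"] kpow_pos[of "length w"]
  by (intro ball_subset_obox) auto

lemma ball_p_Cons_subset: "ball (p (a # w)) (W (length w)) \<subseteq> bar w"
  unfolding bar_def using scaled[of "length w"] kpow_pos[of "length w"]
  by (intro ball_subset_obox) (auto simp: p_Cons_nth)

lemma kpow_ge: "2 * D k \<le> \<kappa> ^ k" "10 * E k \<le> \<kappa> ^ k"
  using scaled[of k] by linarith+

lemma ball_anchor_subset_bar: "ball (anchor w) (W (length w)) \<subseteq> bar w"
  unfolding bar_def using scaled[of "length w"] kpow_ge[of "length w"]
  by (intro ball_subset_obox) (auto simp: anchor_nth)

lemma ball_anchor_subset_tube: "ball (anchor w) (W (length w)) \<subseteq> tube w"
  unfolding tube_def using scaled[of "length w"] ax_Suc_neq[of "length w"]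
  by (intro ball_subset_obox) (auto simp: anchor_nth above_nth)

lemma ball_above_subset_tube: "ball (above w 4) (W (length w)) \<subseteq> tube w"
  unfolding tube_def using scaled[of "length w"] ax_Suc_neq[of "length w"]
  by (intro ball_subset_obox) (auto simp: above_nth)

lemma ball_above_subset_room: "ball (above w 4) (W (length w)) \<subseteq> room w"
  unfolding room_def using scaled[of "length w"] by (intro ball_subset_obox) auto

lemma dist_p_Cons: "dist (p (a # w)) (p w) = \<kappa> ^ length w"
  using kpow_pos[of "length w"] by (simp add: p.simps dist_norm)

lemma dist_anchor_p: "dist (anchor w) (p w) \<le> \<kappa> ^ length w"
  using scaled[of "length w"] kpow_ge[of "length w"] by (simp add: anchor_def dist_norm)

lemma dist_above_anchor: "dist (above w 4) (anchor w) \<le> \<kappa> ^ length w"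
  using scaled[of "length w"] kpow_ge[of "length w"] by (simp add: above_def dist_norm)

lemma dist_bar:
  assumes "x \<in> bar w" shows "dist x (p w) \<le> 2 * real CARD('n) * \<kappa> ^ length w"
proof -
  have "\<bar>x $ l - p w $ l\<bar> \<le> 2 * \<kappa> ^ length w" for l
    using oboxD[OF assms[unfolded bar_def], of l] scaled[of "length w"] kpow_ge[of "length w"]
    by (auto split: if_splits)
  from dist_le_CARD_mult[OF this] show ?thesis by simp
qed

lemma dist_tube:
  assumes "x \<in> tube w" shows "dist x (anchor w) \<le> 2 * real CARD('n) * \<kappa> ^ length w"
proof -
  have "\<bar>x $ l - anchor w $ l\<bar> \<le> 2 * \<kappa> ^ length w" for l
    using oboxD[OF assms[unfolded tube_def], of l] scaled[of "length w"] kpow_ge[of "length w"]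
      ax_Suc_neq[of "length w"]
    by (auto simp: anchor_nth above_nth split: if_splits)
  from dist_le_CARD_mult[OF this] show ?thesis by simp
qed

lemma dist_room:
  assumes "x \<in> room w" shows "dist x (above w 4) \<le> 2 * real CARD('n) * \<kappa> ^ length w"
proof -
  have "\<bar>x $ l - above w 4 $ l\<bar> \<le> 2 * \<kappa> ^ length w" for l
    using oboxD[OF assms[unfolded room_def], of l] scaled[of "length w"] kpow_ge[of "length w"] by auto
  from dist_le_CARD_mult[OF this] show ?thesis by simp
qed

lemma convex_parts [simp]: "convex (bar w)" "convex (tube w)" "convex (room w)"
  by (simp_all add: bar_def tube_def room_def)

text \<open>When a curve has climbed to level k, the length already used is of order
  \<open>\<kappa> ^ k\<close>, since the earlier lengths are dominated by a geometric series, and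
  the width available there is at least of order \<open>W k\<close>, that is, of order
  \<open>(\<kappa> ^ k) powr s\<close>.\<close>

lemma john_domain_G: "john_domain s G"
proof (rule john_domainI[OF s1 bounded_G open_G])
  define N where "N = real CARD('n)"
  \<comment> \<open>\<open>B\<close> is the sum of all bar lengths of a path from the root. The
    offset, in units of \<open>\<kappa> ^ k\<close>, is \<open>A\<close> at the centre of a bar,
    \<open>A - 1\<close> at the foot of the tube and \<open>A - 2\<close> in the room; what is then
    left is at least \<open>2 * N\<close>, enough for the first move inside a box. As
    \<open>A \<ge> B\<close>, the drop of the offset from a bar to its child also pays for the
    length between their centres.\<close>
  define B where "B = 1 / (1 - \<kappa>)"
  define A where "A = 2 * N + 2 + B"
  define c where "c = \<epsilon> / A powr s"
  have N: "N \<ge> 2" using card2 by (simp add: N_def)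
  have B: "0 < B" "B * \<kappa> + 1 = B" using kappa by (auto simp: B_def field_simps)
  have A: "A > 0" "B \<le> A" using N B by (auto simp: A_def)
  show "0 < c" using A eps_pos by (simp add: c_def)
  have cW: "c * (A' * \<kappa> ^ k) powr s \<le> W k" if "0 \<le> A'" "A' \<le> A" for A' k
  proof -
    have "(A' * \<kappa> ^ k) powr s \<le> (A * \<kappa> ^ k) powr s"
      using that kpow_pos[of k] s1 by (intro powr_mono2 mult_right_mono mult_nonneg_nonneg) auto
    also have "\<dots> = A powr s * (\<kappa> ^ k) powr s"
      using A kpow_pos[of k] by (intro powr_mult)
    finally have "c * (A' * \<kappa> ^ k) powr s \<le> c * (A powr s * (\<kappa> ^ k) powr s)"
      using \<open>0 < c\<close> by (intro mult_left_mono) auto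
    also have "\<dots> = W k" using A by (simp add: c_def W_def)
    finally show ?thesis .
  qed
  have step: "A * \<kappa> ^ Suc k + \<kappa> ^ k \<le> A * \<kappa> ^ k" for k
  proof -
    have "1 = B * (1 - \<kappa>)" using kappa by (simp add: B_def)
    also have "\<dots> \<le> A * (1 - \<kappa>)" using A kappa by (intro mult_right_mono) auto
    finally have "1 * \<kappa> ^ k \<le> A * (1 - \<kappa>) * \<kappa> ^ k" using kpow_pos[of k] by (intro mult_right_mono) auto
    then show ?thesis by (simp add: algebra_simps)
  qed
  \<comment> \<open>\<open>B * (1 - \<kappa> ^ k)\<close> is the partial sum of the first k terms of
    the geometric series.\<close>
  have reach_p: "john_reach G (p []) s c (B * (1 - \<kappa> ^ length w)) (A * \<kappa> ^ length w) (p w)" for w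
  proof (induction w)
    case Nil
    have "ball (p []) (c * (A * \<kappa> ^ 0) powr s) \<subseteq> ball (p []) (W 0)"
      using cW[of A 0] A by (intro subset_ball) auto
    also have "\<dots> \<subseteq> G" using ball_p_subset[of "[]"] branch_subset_G(2) by auto
    finally show ?case by (auto intro: john_reach_refl)
  next
    case (Cons a w)
    show ?case
    proof (rule john_reach_prepend_corridor[OF Cons])
      show "convex (bar w)" "bar w \<subseteq> G" by (auto intro!: branch_subset_G(2))
      show "ball (p (a # w)) (W (length w)) \<subseteq> bar w" by (rule ball_p_Cons_subset)
      show "ball (p w) (W (length w)) \<subseteq> bar w" by (rule ball_p_subset)
      show "c * (A * \<kappa> ^ length w) powr s \<le> W (length w)" using cW[of A] A by simp
      show "dist (p (a # w)) (p w) + A * \<kappa> ^ length (a # w) \<le> A * \<kappa> ^ length w"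
        using step[of "length w"] by (simp add: dist_p_Cons)
      have "B * (1 - \<kappa> ^ length w) + (B - B * \<kappa>) * \<kappa> ^ length w = B * (1 - \<kappa> ^ length (a # w))"
        by (simp add: algebra_simps)
      moreover have "B - B * \<kappa> = 1" using B(2) by linarith
      ultimately show "B * (1 - \<kappa> ^ length w) + dist (p (a # w)) (p w) \<le> B * (1 - \<kappa> ^ length (a # w))"
        by (simp add: dist_p_Cons)
    qed (use \<open>0 < c\<close> s1 A kappa in auto)
  qed
  have BL: "B * (1 - \<kappa> ^ k) \<le> B" for k using B kpow_pos[of k] by (simp add: algebra_simps)
  have reach_anchor: "john_reach G (p []) s c (B + 1) ((A - 1) * \<kappa> ^ length w) (anchor w)" for w
  proof (rule john_reach_prepend_corridor[OF reach_p[of w]])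
    show "convex (bar w)" "bar w \<subseteq> G" by (auto intro!: branch_subset_G(2))
    show "ball (anchor w) (W (length w)) \<subseteq> bar w" by (rule ball_anchor_subset_bar)
    show "ball (p w) (W (length w)) \<subseteq> bar w" by (rule ball_p_subset)
    show "c * (A * \<kappa> ^ length w) powr s \<le> W (length w)" using cW[of A] A by simp
    show "dist (anchor w) (p w) + (A - 1) * \<kappa> ^ length w \<le> A * \<kappa> ^ length w"
      using dist_anchor_p[of w] by (simp add: algebra_simps)
    show "B * (1 - \<kappa> ^ length w) + dist (anchor w) (p w) \<le> B + 1"
      using BL[of "length w"] dist_anchor_p[of w] kpow_le_1[of "length w"] by linarith
  qed (use \<open>0 < c\<close> s1 A N B kappa in \<open>auto simp: A_def\<close>)
  have reach_above: "john_reach G (p []) s c (B + 2) ((A - 2) * \<kappa> ^ length w) (above w 4)" for w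
  proof (rule john_reach_prepend_corridor[OF reach_anchor[of w]])
    show "convex (tube w)" "tube w \<subseteq> G" by (auto intro!: branch_subset_G(3))
    show "ball (anchor w) (W (length w)) \<subseteq> tube w" by (rule ball_anchor_subset_tube)
    show "ball (above w 4) (W (length w)) \<subseteq> tube w" by (rule ball_above_subset_tube)
    show "c * ((A - 1) * \<kappa> ^ length w) powr s \<le> W (length w)" using cW[of "A - 1"] N B A by (simp add: A_def)
    show "dist (above w 4) (anchor w) + (A - 2) * \<kappa> ^ length w \<le> (A - 1) * \<kappa> ^ length w"
      using dist_above_anchor[of w] by (simp add: algebra_simps)
    show "B + 1 + dist (above w 4) (anchor w) \<le> B + 2"
      using dist_above_anchor[of w] kpow_le_1[of "length w"] by linarith
  qed (use \<open>0 < c\<close> s1 A N B kappa in \<open>auto simp: A_def\<close>)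
  have le: "2 * N * \<kappa> ^ k \<le> 2 * N" for k using N kpow_le_1[of k] by simp
  have le': "2 * N * \<kappa> ^ k \<le> A' * \<kappa> ^ k" if "A - 2 \<le> A'" for k A'
    using that N B kappa by (intro mult_right_mono) (auto simp: A_def)
  show "p [] \<in> G" using p_in_bar branch_subset_G(2) by blast
  fix x assume "x \<in> G"
  then obtain w where "x \<in> bar w \<or> x \<in> tube w \<or> x \<in> room w" by (auto simp: G_def branch_def)
  then show "john_reach G (p []) s c (B + 2 + 2 * N) 0 x"
  proof (elim disjE)
    assume x: "x \<in> bar w"
    show ?thesis
    proof (rule john_reach_prepend_convex[OF reach_p[of w] _ s1 _ _ _ branch_subset_G(2) x ball_p_subset])
      show "dist x (p w) \<le> A * \<kappa> ^ length w"
        using dist_bar[OF x] le'[of A "length w"] by (simp add: N_def)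
      show "B * (1 - \<kappa> ^ length w) + dist x (p w) \<le> B + 2 + 2 * N"
        using dist_bar[OF x, folded N_def] le[of "length w"] BL[of "length w"] by linarith
      show "c * (A * \<kappa> ^ length w) powr s \<le> W (length w)" using cW[of A] A by simp
    qed (use \<open>0 < c\<close> in auto)
  next
    assume x: "x \<in> tube w"
    show ?thesis
    proof (rule john_reach_prepend_convex[OF reach_anchor[of w] _ s1 _ _ _ branch_subset_G(3) x ball_anchor_subset_tube])
      show "dist x (anchor w) \<le> (A - 1) * \<kappa> ^ length w"
        using dist_tube[OF x] le'[of "A - 1" "length w"] by (simp add: N_def)
      show "B + 1 + dist x (anchor w) \<le> B + 2 + 2 * N"
        using dist_tube[OF x, folded N_def] le[of "length w"] by linarith
      show "c * ((A - 1) * \<kappa> ^ length w) powr s \<le> W (length w)" using cW[of "A - 1"] N B A by (simp add: A_def)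
    qed (use \<open>0 < c\<close> in auto)
  next
    assume x: "x \<in> room w"
    show ?thesis
    proof (rule john_reach_prepend_convex[OF reach_above[of w] _ s1 _ _ _ branch_subset_G(4) x ball_above_subset_room])
      show "dist x (above w 4) \<le> (A - 2) * \<kappa> ^ length w"
        using dist_room[OF x] le'[of "A - 2" "length w"] by (simp add: N_def)
      show "B + 2 + dist x (above w 4) \<le> B + 2 + 2 * N"
        using dist_room[OF x, folded N_def] le[of "length w"] by linarith
      show "c * ((A - 2) * \<kappa> ^ length w) powr s \<le> W (length w)" using cW[of "A - 2"] N B A by (simp add: A_def)
    qed (use \<open>0 < c\<close> in auto)
  qed
qed

end

section \<open>The Minkowski dimension of the boundary\<close>

definition thicken :: "'a::metric_space set \<Rightarrow> real \<Rightarrow> 'a set" where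
  "thicken S r = (\<Union>x\<in>S. ball x r)"

lemma thicken_eq_sums:
  fixes S :: "'a::euclidean_space set"
  shows "thicken S r = {x + y | x y. x \<in> S \<and> y \<in> ball 0 r}"
proof (intro set_eqI iffI)
  fix z assume "z \<in> thicken S r"
  then obtain x where "x \<in> S" "dist x z < r" by (auto simp: thicken_def)
  then show "z \<in> {x + y | x y. x \<in> S \<and> y \<in> ball 0 r}"
    by (intro CollectI exI[of _ x] exI[of _ "z - x"]) (auto simp: dist_norm norm_minus_commute)
qed (force simp: thicken_def dist_norm)

lemma thicken_mono: "S \<subseteq> T \<Longrightarrow> thicken S r \<subseteq> thicken T r"
  by (auto simp: thicken_def)

lemma thicken_Un: "thicken (S \<union> T) r = thicken S r \<union> thicken T r"
  by (auto simp: thicken_def)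

lemma thicken_UN: "thicken (\<Union>i\<in>I. S i) r = (\<Union>i\<in>I. thicken (S i) r)"
  by (auto simp: thicken_def)

lemma thicken_sets [measurable]: "thicken S r \<in> sets borel"
  by (auto simp: thicken_def intro!: borel_open)

lemma sets_kbox [measurable]: "kbox c h \<in> sets borel" and sets_obox [measurable]: "obox c h \<in> sets borel"
  by (auto intro: borel_closed borel_open)

lemma emeasure_kbox:
  fixes h :: "'n::finite \<Rightarrow> real"
  assumes "\<And>l. 0 \<le> h l"
  shows "emeasure lborel (kbox c h) = ennreal (\<Prod>l\<in>UNIV. 2 * h l)"
proof -
  have ne: "kbox c h \<noteq> {}" using assms by (auto simp: kbox_def intro!: exI[of _ c])
  have "emeasure lborel (kbox c h) = ennreal (measure lborel (kbox c h))"
    unfolding kbox_eq_cbox by (rule emeasure_eq_ennreal_measure) (simp add: emeasure_lborel_cbox_eq)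
  also have "measure lborel (kbox c h) = (\<Prod>l\<in>UNIV. 2 * h l)"
    using content_cbox_cart[OF ne[unfolded kbox_eq_cbox]] by (simp add: kbox_eq_cbox)
  finally show ?thesis .
qed

lemma emeasure_obox:
  fixes h :: "'n::finite \<Rightarrow> real"
  assumes "\<And>l. 0 \<le> h l"
  shows "emeasure lborel (obox c h) = ennreal (\<Prod>l\<in>UNIV. 2 * h l)"
proof -
  have "emeasure lborel (obox c h) = emeasure lborel (kbox c h)"
    unfolding obox_eq_box kbox_eq_cbox by (simp add: emeasure_lborel_box_eq emeasure_lborel_cbox_eq)
  then show ?thesis using emeasure_kbox[OF assms, of c] by simp
qed

lemma thicken_kbox_subset: "thicken (kbox c h) r \<subseteq> kbox c (\<lambda>l. h l + r)"
proof
  fix z assume "z \<in> thicken (kbox c h) r"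
  then obtain x where x: "x \<in> kbox c h" "norm (z - x) < r"
    by (auto simp: thicken_def dist_norm norm_minus_commute)
  show "z \<in> kbox c (\<lambda>l. h l + r)" unfolding kbox_def
  proof clarify
    fix l
    show "\<bar>z $ l - c $ l\<bar> \<le> h l + r"
      using kboxD[OF x(1), of l] component_le_norm_cart[of "z - x" l] x(2) by simp
  qed
qed

lemma kbox_diff_obox_subset:
  fixes c :: "real ^ 'n"
  shows "kbox c h - obox c h \<subseteq> (\<Union>(l, \<sigma>)\<in>UNIV \<times> {-1, 1}. kbox (c + (\<sigma> * h l) *\<^sub>R axis l 1) (h(l := 0)))"
proof
  fix x assume x: "x \<in> kbox c h - obox c h"
  then obtain l where l: "\<bar>x $ l - c $ l\<bar> = h l" by (auto simp: kbox_def obox_def not_less intro: antisym)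
  define \<sigma> :: real where "\<sigma> = (if 0 \<le> x $ l - c $ l then 1 else -1)"
  have "x \<in> kbox (c + (\<sigma> * h l) *\<^sub>R axis l 1) (h(l := 0))"
    using x l by (auto simp: kbox_def \<sigma>_def axis_def)
  moreover have "\<sigma> \<in> {-1, 1}" by (auto simp: \<sigma>_def)
  ultimately show "x \<in> (\<Union>(l, \<sigma>)\<in>UNIV \<times> {-1, 1}. kbox (c + (\<sigma> * h l) *\<^sub>R axis l 1) (h(l := 0)))" by blast
qed

text \<open>Each of the \<open>2 * CARD('n)\<close> faces is a box with one half-width 0. Thickening
  turns this into \<open>r\<close> and leaves the other half-widths at most
  \<open>L + r\<close>.\<close>

lemma emeasure_thicken_box_boundary_le:
  fixes c :: "real ^ 'n"
  assumes h: "\<And>l. 0 \<le> h l" "\<And>l. h l \<le> L" and r: "0 < r"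
  shows "emeasure lborel (thicken (kbox c h - obox c h) r)
      \<le> ennreal (4 * real CARD('n) * r * (2 * (L + r)) ^ (CARD('n) - 1))"
proof -
  let ?I = "(UNIV :: 'n set) \<times> {-1, 1 :: real}"
  define B where "B = (\<lambda>(l, \<sigma>). kbox (c + (\<sigma> * h l) *\<^sub>R axis l 1) (\<lambda>j. (h(l := 0)) j + r))"
  have "thicken (kbox c h - obox c h) r
      \<subseteq> (\<Union>(l, \<sigma>)\<in>?I. thicken (kbox (c + (\<sigma> * h l) *\<^sub>R axis l 1) (h(l := 0))) r)"
    using thicken_mono[OF kbox_diff_obox_subset, of c h r] unfolding thicken_UN by (simp add: case_prod_unfold)
  also have "\<dots> \<subseteq> (\<Union>i\<in>?I. B i)" unfolding B_def using thicken_kbox_subset by fastforce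
  finally have "emeasure lborel (thicken (kbox c h - obox c h) r) \<le> emeasure lborel (\<Union>i\<in>?I. B i)"
    by (intro emeasure_mono) (auto simp: B_def)
  also have "\<dots> \<le> (\<Sum>i\<in>?I. emeasure lborel (B i))"
    by (rule emeasure_subadditive_finite) (auto simp: B_def)
  also have "\<dots> \<le> (\<Sum>i\<in>?I. ennreal (2 * r * (2 * (L + r)) ^ (CARD('n) - 1)))"
  proof (rule sum_mono, clarify)
    fix l and \<sigma> :: real
    have "emeasure lborel (B (l, \<sigma>)) = ennreal (\<Prod>j\<in>UNIV. 2 * ((h(l := 0)) j + r))"
      unfolding B_def prod.case using h r by (intro emeasure_kbox) (auto simp: add_nonneg_nonneg)
    also have "(\<Prod>j\<in>UNIV. 2 * ((h(l := 0)) j + r)) = 2 * r * (\<Prod>j\<in>UNIV - {l}. 2 * (h j + r))"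
      by (subst prod.remove[of _ l]) auto
    also have "ennreal (2 * r * (\<Prod>j\<in>UNIV - {l}. 2 * (h j + r)))
        \<le> ennreal (2 * r * (\<Prod>j\<in>UNIV - {l}. 2 * (L + r)))"
      using h r by (intro ennreal_leI mult_left_mono prod_mono) (auto simp: add_nonneg_nonneg)
    also have "(\<Prod>j\<in>UNIV - {l}. 2 * (L + r)) = (2 * (L + r)) ^ (CARD('n) - 1)"
      by (simp add: card_Diff_singleton)
    finally show "emeasure lborel (B (l, \<sigma>)) \<le> ennreal (2 * r * (2 * (L + r)) ^ (CARD('n) - 1))" .
  qed
  also have "\<dots> = ennreal (4 * real CARD('n) * r * (2 * (L + r)) ^ (CARD('n) - 1))"
    using h(1) h(2) r order_trans[OF h(1) h(2)]
    by (subst sum_ennreal) (auto simp: card_cartesian_product algebra_simps)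
  finally show ?thesis .
qed

lemma frontier_between:
  fixes x y :: "'a::euclidean_space"
  assumes "x \<in> S" "y \<notin> S"
  obtains z where "z \<in> frontier S" "z \<in> closed_segment x y" "dist x z \<le> dist x y"
proof -
  have "closed_segment x y \<inter> frontier S \<noteq> {}"
    using assms by (intro connected_Int_frontier) auto
  then obtain z where z: "z \<in> closed_segment x y" "z \<in> frontier S" by blast
  moreover have "dist x z \<le> dist x y"
    using segment_bound(1)[OF z(1)] by (simp add: dist_norm norm_minus_commute)
  ultimately show ?thesis using that by blast
qed

definition words :: "nat \<Rightarrow> bool list set" where "words k = {w. length w = k}"

lemma finite_words [simp]: "finite (words k)" and card_words: "card (words k) = 2 ^ k"
  using finite_lists_length_eq[of "UNIV :: bool set" k] card_lists_length_eq[of "UNIV :: bool set" k]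
  by (auto simp: words_def)

lemma sum_words_ennreal: "0 \<le> c \<Longrightarrow> (\<Sum>w\<in>words k. ennreal c) = ennreal (2 ^ k * c)"
  by (subst sum_ennreal) (auto simp: card_words)

section \<open>Covering the boundary at a given scale\<close>

context room_tree begin

text \<open>The frontier of an infinite union may contain accumulation points outside the frontiers
  of its members. Here all branches from level \<open>K\<close> on lie in finitely many closed
  cells, so only finitely many pieces remain to be treated one by one.\<close>

lemma frontier_G_subset:
  "frontier G \<subseteq> (\<Union>k<K. \<Union>w\<in>words k. frontier (bar w) \<union> frontier (tube w) \<union> frontier (room w))
     \<union> (\<Union>w\<in>words K. cell w)"
proof
  fix x assume x: "x \<in> frontier G"
  define A where "A = (\<Union>k<K. \<Union>w\<in>words k. branch w)"
  define C where "C = (\<Union>w\<in>words K. cell w)"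
  have "closed C" by (auto simp: C_def cell_def)
  have "G \<subseteq> A \<union> C"
  proof
    fix x assume "x \<in> G"
    then obtain w where w: "x \<in> branch w" by (auto simp: G_def)
    show "x \<in> A \<union> C"
    proof (cases "length w < K")
      case True
      then show ?thesis using w by (auto simp: A_def words_def)
    next
      case False
      then obtain v w' where "w = v @ w'" "length w' = K" using split_at_level[of K w] by auto
      then have "x \<in> cell w'" using w branch_subset_cell[of w] cell_append_subset[of v w'] by auto
      then show ?thesis using \<open>length w' = K\<close> by (auto simp: C_def words_def)
    qed
  qed
  moreover have "closure A \<subseteq> (\<Union>k<K. \<Union>w\<in>words k. closure (branch w))"
  proof (rule closure_minimal)
    show "A \<subseteq> (\<Union>k<K. \<Union>w\<in>words k. closure (branch w))"
      unfolding A_def using closure_subset by blast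
    show "closed (\<Union>k<K. \<Union>w\<in>words k. closure (branch w))" by (intro closed_UN ballI) auto
  qed
  ultimately have "closure G \<subseteq> (\<Union>k<K. \<Union>w\<in>words k. closure (branch w)) \<union> C"
    using closure_mono[of G "A \<union> C"] \<open>closed C\<close> by (auto simp: closure_Un)
  moreover have "x \<in> closure G" "x \<notin> G"
    using x open_G by (auto simp: frontier_def interior_open)
  ultimately consider k w where "k < K" "w \<in> words k" "x \<in> closure (branch w)" | "x \<in> C"
    by blast
  then show "x \<in> (\<Union>k<K. \<Union>w\<in>words k. frontier (bar w) \<union> frontier (tube w) \<union> frontier (room w))
     \<union> (\<Union>w\<in>words K. cell w)"
  proof cases
    case (1 k w)
    have "x \<notin> interior (bar w)" "x \<notin> interior (tube w)" "x \<notin> interior (room w)"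
      using \<open>x \<notin> G\<close> branch_subset_G[of w] interior_subset by blast+
    then have "x \<in> frontier (bar w) \<union> frontier (tube w) \<union> frontier (room w)"
      using 1(3) by (auto simp: branch_def closure_Un frontier_def)
    then show ?thesis using 1 by blast
  qed (simp add: C_def)
qed

lemma emeasure_thicken_frontier_parts:
  assumes "X \<in> {bar w, tube w, room w}" "0 < r" "r \<le> \<kappa> ^ length w"
  shows "emeasure lborel (thicken (frontier X) r)
    \<le> ennreal (4 * real CARD('n) * r * (6 * \<kappa> ^ length w) ^ (CARD('n) - 1))"
proof -
  let ?k = "length w"
  have bounds: "0 < E ?k" "W ?k \<le> E ?k" "0 < W ?k" "10 * E ?k \<le> \<kappa> ^ ?k"
    using scaled[of ?k] kpow_ge[of ?k] by auto
  have "\<exists>c h. X = obox c h \<and> (\<forall>l. 0 \<le> h l \<and> h l \<le> 2 * \<kappa> ^ ?k)"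
    using assms(1)
  proof (elim insertE emptyE)
    assume "X = bar w"
    then show ?thesis unfolding bar_def using bounds by (intro exI conjI) auto
  next
    assume "X = tube w"
    then show ?thesis unfolding tube_def using bounds by (intro exI conjI) auto
  next
    assume "X = room w"
    then show ?thesis unfolding room_def using bounds by (intro exI conjI) auto
  qed
  then obtain c h where X: "X = obox c h" "\<And>l. 0 \<le> h l" "\<And>l. h l \<le> 2 * \<kappa> ^ ?k" by blast
  have "emeasure lborel (thicken (frontier X) r) \<le> emeasure lborel (thicken (kbox c h - obox c h) r)"
    using frontier_obox_subset[of c h] X by (intro emeasure_mono thicken_mono) auto
  also have "\<dots> \<le> ennreal (4 * real CARD('n) * r * (2 * (2 * \<kappa> ^ ?k + r)) ^ (CARD('n) - 1))"
    using X assms by (intro emeasure_thicken_box_boundary_le) auto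
  also have "\<dots> \<le> ennreal (4 * real CARD('n) * r * (6 * \<kappa> ^ ?k) ^ (CARD('n) - 1))"
    using assms kpow_pos[of ?k] by (intro ennreal_leI mult_left_mono power_mono) auto
  finally show ?thesis .
qed

lemma emeasure_thicken_cell:
  assumes "0 < r" "r \<le> \<kappa> ^ length w"
  shows "emeasure lborel (thicken (cell w) r) \<le> ennreal ((6 * \<kappa> ^ length w) ^ CARD('n))"
proof -
  have H: "0 \<le> H (length w) l" for l using kappa by (simp add: H_def)
  have "emeasure lborel (thicken (cell w) r) \<le> emeasure lborel (kbox (p w) (\<lambda>l. H (length w) l + r))"
    unfolding cell_def by (intro emeasure_mono thicken_kbox_subset) simp
  also have "\<dots> = ennreal (\<Prod>l\<in>UNIV. 2 * (H (length w) l + r))"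
    using H assms by (intro emeasure_kbox) (simp add: add_nonneg_nonneg)
  also have "(\<Prod>l\<in>UNIV. 2 * (H (length w) l + r)) \<le> (\<Prod>l\<in>(UNIV :: 'n set). 6 * \<kappa> ^ length w)"
    using H H_le[of "length w"] assms
    by (intro prod_mono) (smt (verit, best))
  finally show ?thesis by (simp add: ennreal_leI)
qed

text \<open>Used with \<open>K\<close> the level of size about \<open>r\<close>: pieces larger than
  \<open>r\<close> are counted by their surface, everything smaller by the volume of the cells. Both
  counts lead to \<open>(2 * \<kappa> ^ CARD('n)) ^ K\<close>.\<close>

lemma emeasure_thicken_frontier_G:
  assumes r: "0 < r" "r \<le> \<kappa> ^ K" and growth: "1 \<le> 2 * \<kappa> ^ (CARD('n) - 1)"
  shows "emeasure lborel (thicken (frontier G) r)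
    \<le> ennreal (12 * real CARD('n) * 6 ^ CARD('n) * (real K + 1) * (2 * \<kappa> ^ CARD('n)) ^ K)"
proof -
  let ?n = "CARD('n)"
  define F where "F w = frontier (bar w) \<union> frontier (tube w) \<union> frontier (room w)" for w
  define X where "X = (\<Union>k<K. \<Union>w\<in>words k. F w)"
  define Y where "Y = (\<Union>w\<in>words K. cell w)"
  have F: "emeasure lborel (thicken (F w) r) \<le> ennreal (12 * real ?n * r * (6 * \<kappa> ^ k) ^ (?n - 1))"
    if "w \<in> words k" "k < K" for w k
  proof -
    have "\<kappa> ^ K \<le> \<kappa> ^ k" using that kappa by (intro power_decreasing) auto
    then have k: "length w = k" "r \<le> \<kappa> ^ k"
      using that r by (auto simp: words_def)
    define c where "c = 4 * real ?n * r * (6 * \<kappa> ^ k) ^ (?n - 1)"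
    have c: "0 \<le> c" using r kappa by (simp add: c_def)
    have "emeasure lborel (thicken (F w) r) \<le> emeasure lborel (thicken (frontier (bar w)) r)
        + emeasure lborel (thicken (frontier (tube w)) r) + emeasure lborel (thicken (frontier (room w)) r)"
      unfolding F_def thicken_Un
      by (intro order_trans[OF emeasure_subadditive] add_right_mono) auto
    also have "\<dots> \<le> ennreal c + ennreal c + ennreal c"
      unfolding c_def using emeasure_thicken_frontier_parts[of _ w r] r k by (intro add_mono) auto
    also have "\<dots> = ennreal (12 * real ?n * r * (6 * \<kappa> ^ k) ^ (?n - 1))"
      using c by (simp add: c_def flip: ennreal_plus)
    finally show ?thesis .
  qed
  have "emeasure lborel (thicken X r) \<le> (\<Sum>k<K. \<Sum>w\<in>words k. emeasure lborel (thicken (F w) r))"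
    unfolding X_def thicken_UN
    by (intro order_trans[OF emeasure_subadditive_finite] sum_mono) auto
  also have "\<dots> \<le> (\<Sum>k<K. \<Sum>w\<in>words k. ennreal (12 * real ?n * r * (6 * \<kappa> ^ k) ^ (?n - 1)))"
    using F by (intro sum_mono) auto
  also have "\<dots> = ennreal (\<Sum>k<K. \<Sum>w\<in>words k. 12 * real ?n * r * (6 * \<kappa> ^ k) ^ (?n - 1))"
    using r kappa by (subst sum_ennreal[symmetric], simp add: sum_nonneg,
      intro sum.cong refl sum_ennreal) auto
  also have "(\<Sum>k<K. \<Sum>w\<in>words k. 12 * real ?n * r * (6 * \<kappa> ^ k) ^ (?n - 1))
      \<le> (\<Sum>k<K. 12 * real ?n * 6 ^ (?n - 1) * (2 * \<kappa> ^ ?n) ^ K)"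
  proof (rule sum_mono)
    fix k assume "k \<in> {..<K}"
    have "(\<Sum>w\<in>words k. 12 * real ?n * r * (6 * \<kappa> ^ k) ^ (?n - 1))
        = 12 * real ?n * 6 ^ (?n - 1) * (r * (2 * \<kappa> ^ (?n - 1)) ^ k)"
      by (simp add: card_words power_mult_distrib power_mult[symmetric] mult_ac)
    \<comment> \<open>By \<open>growth\<close> the total surface of a level does not decrease with
      the level, so each level is bounded by the value at \<open>K\<close>. When \<open>lam\<close>
      is the dimension minus 1 all levels weigh the same, and the factor \<open>real K\<close> is
      then the honest count.\<close>
    also have "\<dots> \<le> 12 * real ?n * 6 ^ (?n - 1) * (\<kappa> ^ K * (2 * \<kappa> ^ (?n - 1)) ^ K)"
      using r growth kappa \<open>k \<in> {..<K}\<close>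
      by (intro mult_left_mono mult_mono power_increasing) auto
    also have "\<kappa> ^ K * (2 * \<kappa> ^ (?n - 1)) ^ K = (2 * (\<kappa> * \<kappa> ^ (?n - 1))) ^ K"
      by (simp add: power_mult_distrib mult_ac)
    also have "\<kappa> * \<kappa> ^ (?n - 1) = \<kappa> ^ ?n"
      using card2 by (simp flip: power_Suc)
    finally show "(\<Sum>w\<in>words k. 12 * real ?n * r * (6 * \<kappa> ^ k) ^ (?n - 1))
        \<le> 12 * real ?n * 6 ^ (?n - 1) * (2 * \<kappa> ^ ?n) ^ K" .
  qed
  also have "\<dots> \<le> 12 * real ?n * 6 ^ ?n * real K * (2 * \<kappa> ^ ?n) ^ K"
    using kappa power_increasing[of "?n - 1" ?n "6::real"]
    by (simp add: mult_ac) (intro mult_left_mono mult_right_mono, auto)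
  finally have X: "emeasure lborel (thicken X r) \<le> ennreal (12 * real ?n * 6 ^ ?n * real K * (2 * \<kappa> ^ ?n) ^ K)"
    by (simp add: ennreal_leI)
  have "emeasure lborel (thicken Y r) \<le> (\<Sum>w\<in>words K. emeasure lborel (thicken (cell w) r))"
    unfolding Y_def thicken_UN by (intro emeasure_subadditive_finite) auto
  also have "\<dots> \<le> (\<Sum>w\<in>words K. ennreal ((6 * \<kappa> ^ K) ^ ?n))"
    using emeasure_thicken_cell r by (intro sum_mono) (auto simp: words_def)
  also have "\<dots> = ennreal (2 ^ K * (6 * \<kappa> ^ K) ^ ?n)"
    using kappa by (intro sum_words_ennreal) auto
  also have "2 ^ K * (6 * \<kappa> ^ K) ^ ?n = 6 ^ ?n * (2 * \<kappa> ^ ?n) ^ K"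
    by (simp add: power_mult_distrib power_mult[symmetric] mult_ac)
  also have "\<dots> \<le> ennreal (12 * real ?n * 6 ^ ?n * (2 * \<kappa> ^ ?n) ^ K)"
    using card2 kappa by (intro ennreal_leI mult_right_mono) auto
  finally have Y: "emeasure lborel (thicken Y r) \<le> ennreal (12 * real ?n * 6 ^ ?n * (2 * \<kappa> ^ ?n) ^ K)" .
  have "emeasure lborel (thicken (frontier G) r) \<le> emeasure lborel (thicken X r \<union> thicken Y r)"
    unfolding thicken_Un[symmetric] X_def Y_def F_def
    by (intro emeasure_mono thicken_mono frontier_G_subset) simp
  also have "\<dots> \<le> emeasure lborel (thicken X r) + emeasure lborel (thicken Y r)"
    by (intro emeasure_subadditive) auto
  also have "\<dots> \<le> ennreal (12 * real ?n * 6 ^ ?n * real K * (2 * \<kappa> ^ ?n) ^ K)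
      + ennreal (12 * real ?n * 6 ^ ?n * (2 * \<kappa> ^ ?n) ^ K)"
    by (intro add_mono X Y)
  also have "\<dots> = ennreal (12 * real ?n * 6 ^ ?n * (real K + 1) * (2 * \<kappa> ^ ?n) ^ K)"
    using kappa by (subst ennreal_plus[symmetric]) (auto simp: algebra_simps)
  finally show ?thesis .
qed

section \<open>Rooms close to the boundary\<close>

lemma near_complement:
  assumes "x \<in> room w"
  shows "\<exists>z\<in>frontier G. dist x z < 4 * real CARD('n) * E (length w)"
proof -
  let ?i = "ax (length w)" and ?k = "length w"
  \<comment> \<open>The room's centre is pushed sideways by \<open>2 * E\<close>: out of the room,
    but not out of the casing, whose remaining part is free of \<open>G\<close>.\<close>
  define y where "y = above w 4 + (2 * E ?k) *\<^sub>R axis ?i 1"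
  have y: "y $ l = above w 4 $ l + (if l = ?i then 2 * E ?k else 0)" for l
    by (auto simp: y_def axis_def)
  have "y \<in> casing w"
    unfolding casing_def kbox_def using y scaled(1)[of ?k] by auto
  moreover have "y \<notin> tube w \<union> room w"
    using chamber_axis[of y w] y[of ?i] scaled(1)[of ?k] by (auto simp: above_nth)
  ultimately have "y \<notin> G" using casing_Int_G by blast
  moreover have "x \<in> G" using assms branch_subset_G(4) by blast
  ultimately obtain z where z: "z \<in> frontier G" "dist x z \<le> dist x y" by (metis frontier_between)
  have "\<bar>x $ l - y $ l\<bar> \<le> 3 * E ?k" for l
    using oboxD[OF assms[unfolded room_def], of l] y[of l] scaled(1)[of ?k] by auto
  from dist_le_CARD_mult[OF this] have "dist x y \<le> 3 * real CARD('n) * E ?k" by simp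
  also have "\<dots> < 4 * real CARD('n) * E ?k"
    using card2 scaled(1)[of ?k] by (intro mult_strict_right_mono) auto
  finally show ?thesis using z by (intro bexI[of _ z]) auto
qed

lemma rooms_disjoint: "u \<noteq> w \<Longrightarrow> room u \<inter> room w = {}"
  using casing_Int_branch[of u w] room_subset_casing[of w] by (auto simp: branch_def)

lemma emeasure_room: "emeasure lborel (room w) = ennreal ((2 * E (length w)) ^ CARD('n))"
  unfolding room_def using scaled(1)[of "length w"] by (subst emeasure_obox) auto

text \<open>The rooms of one level are disjoint and all within reach of the boundary, so their total
  volume is a lower bound.\<close>

lemma emeasure_thicken_frontier_G_ge:
  "ennreal ((2 * \<epsilon>) ^ CARD('n) * (2 * \<kappa> ^ CARD('n)) ^ k)
    \<le> emeasure lborel (thicken (frontier G) (4 * real CARD('n) * E k))"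
proof -
  have "ennreal ((2 * \<epsilon>) ^ CARD('n) * (2 * \<kappa> ^ CARD('n)) ^ k) = (\<Sum>w\<in>words k. ennreal ((2 * E k) ^ CARD('n)))"
    using scaled(1)[of k] by (simp only: sum_words_ennreal zero_le_power mult_nonneg_nonneg less_imp_le
        zero_le_numeral) (simp add: E_def power_mult_distrib power_mult[symmetric] mult_ac)
  also have "\<dots> = (\<Sum>w\<in>words k. emeasure lborel (room w))"
    by (intro sum.cong) (auto simp: emeasure_room words_def)
  also have "\<dots> = emeasure lborel (\<Union>w\<in>words k. room w)"
    using rooms_disjoint
    by (intro sum_emeasure) (auto simp: disjoint_family_on_def room_def)
  also have "\<dots> \<le> emeasure lborel (thicken (frontier G) (4 * real CARD('n) * E k))"
  proof (rule emeasure_mono)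
    show "(\<Union>w\<in>words k. room w) \<subseteq> thicken (frontier G) (4 * real CARD('n) * E k)"
      using near_complement by (fastforce simp: thicken_def words_def dist_commute)
  qed simp
  finally show ?thesis .
qed

end

section \<open>From volumes to the dimension\<close>

lemma bounded_linear_times_geometric:
  fixes x :: real
  assumes "0 < x" "x < 1"
  shows "\<exists>B. \<forall>k. (real k + 1) * x ^ k \<le> B"
proof -
  have "(\<lambda>k. of_nat k * x ^ k) \<longlonglongrightarrow> 0" using assms by (intro powser_times_n_limit_0) auto
  then have "Bseq (\<lambda>k. of_nat k * x ^ k)" by (intro convergent_imp_Bseq) (auto simp: convergent_def)
  then obtain B where B: "\<And>k. norm (real k * x ^ k) \<le> B" by (auto simp: Bseq_def)
  have "(real k + 1) * x ^ k \<le> B / x" for k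
  proof -
    have "real (Suc k) * x ^ Suc k \<le> B" using B[of "Suc k"] by (metis abs_le_D1 real_norm_def)
    then show ?thesis using assms by (simp add: field_simps)
  qed
  then show ?thesis by blast
qed

text \<open>Finds the level belonging to a scale \<open>r\<close>: applied with \<kappa> to the
  boundary and with 1/2 to the dyadic shells.\<close>

lemma power_bracket:
  fixes x r :: real
  assumes "0 < x" "x < 1" "0 < r" "r < 1"
  obtains K where "x ^ Suc K < r" "r \<le> x ^ K"
proof -
  define k where "k = (LEAST k. x ^ k < r)"
  have ex: "\<exists>k. x ^ k < r" using assms by (intro real_arch_pow_inv)
  have k: "x ^ k < r" unfolding k_def by (rule LeastI_ex[OF ex])
  then obtain K where K: "k = Suc K" using assms by (cases k) auto
  then have "\<not> x ^ K < r" using not_less_Least[of K "\<lambda>k. x ^ k < r"] by (simp add: k_def)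
  then show ?thesis using that[of K] k K by auto
qed

context room_tree begin

lemma kpow_powr: "(\<kappa> ^ k) powr a = (\<kappa> powr a) ^ k"
  using kappa by (simp add: powr_power powr_powr mult.commute flip: powr_realpow)

lemma powr_split: "2 * \<kappa> powr \<mu> = 2 * \<kappa> ^ CARD('n) * \<kappa> powr (\<mu> - CARD('n))"
  using kappa by (simp add: powr_diff powr_realpow)

text \<open>At scale \<open>\<kappa> ^ K\<close> the product is at most a constant times
  \<open>(K + 1) * (2 * \<kappa> powr \<nu>) ^ K\<close>, whose ratio is below 1 because
  \<open>\<nu> > lam\<close>. A linear factor in \<open>K\<close> therefore does not affect the
  dimension.\<close>

lemma thicken_frontier_G_upper:
  assumes lam: "\<kappa> powr lam = 1 / 2" "real CARD('n) - 1 \<le> lam" "lam < real CARD('n)" and \<mu>: "lam < \<mu>"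
  shows "\<exists>C. \<forall>r. 0 < r \<longrightarrow> r < 1 \<longrightarrow> emeasure lborel (thicken (frontier G) r)
    * ennreal (r powr (\<mu> - real CARD('n))) \<le> ennreal C"
proof -
  let ?n = "CARD('n)"
  \<comment> \<open>Truncating at the dimension of the space keeps the exponent
    \<open>\<nu> - ?n\<close> nonpositive, so that replacing \<open>r\<close> by the smaller
    \<open>\<kappa> ^ Suc K\<close> increases the power.\<close>
  define \<nu> where "\<nu> = min \<mu> ?n"
  have \<nu>: "lam < \<nu>" "\<nu> \<le> \<mu>" "\<nu> \<le> ?n" using \<mu> lam by (auto simp: \<nu>_def)
  define x where "x = 2 * \<kappa> powr \<nu>"
  have "\<kappa> powr \<nu> < \<kappa> powr lam" using kappa \<nu> by (intro powr_less_mono') auto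
  then have x: "0 < x" "x < 1" using lam kappa by (auto simp: x_def)
  have growth: "1 \<le> 2 * \<kappa> ^ (?n - 1)"
  proof -
    have "\<kappa> powr lam \<le> \<kappa> powr real (?n - 1)" using kappa lam card2 by (intro powr_mono') (auto simp: of_nat_diff)
    also have "\<kappa> powr real (?n - 1) = \<kappa> ^ (?n - 1)" using kappa by (intro powr_realpow)
    finally show ?thesis using lam(1) by simp
  qed
  from bounded_linear_times_geometric[OF x] obtain B where B: "\<And>k. (real k + 1) * x ^ k \<le> B" by blast
  define c where "c = 12 * real ?n * 6 ^ ?n"
  define d where "d = \<kappa> powr (\<nu> - ?n)"
  have cd: "0 \<le> c" "0 < d" using kappa by (auto simp: c_def d_def)
  have "emeasure lborel (thicken (frontier G) r) * ennreal (r powr (\<mu> - ?n)) \<le> ennreal (c * d * B)"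
    if r: "0 < r" "r < 1" for r
  proof -
    obtain K where K: "\<kappa> ^ Suc K < r" "r \<le> \<kappa> ^ K" using power_bracket[OF kappa(1,2) r] by blast
    have "r powr (\<mu> - ?n) \<le> r powr (\<nu> - ?n)" using r \<nu> by (intro powr_mono') auto
    also have "\<dots> \<le> (\<kappa> ^ Suc K) powr (\<nu> - ?n)"
      using K kpow_pos[of "Suc K"] \<nu> by (intro powr_mono2') auto
    also have "\<dots> = d * d ^ K"
      unfolding kpow_powr[of "Suc K"] d_def by (rule power_Suc)
    finally have rp: "r powr (\<mu> - ?n) \<le> d * d ^ K" .
    have "emeasure lborel (thicken (frontier G) r) * ennreal (r powr (\<mu> - ?n))
        \<le> ennreal (c * (real K + 1) * (2 * \<kappa> ^ ?n) ^ K) * ennreal (d * d ^ K)"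
      unfolding c_def using emeasure_thicken_frontier_G[OF r(1) K(2) growth] rp
      by (intro mult_mono) (auto intro: ennreal_leI)
    also have "\<dots> = ennreal (c * (real K + 1) * (2 * \<kappa> ^ ?n) ^ K * (d * d ^ K))"
      using cd kappa by (intro ennreal_mult[symmetric]) auto
    also have "c * (real K + 1) * (2 * \<kappa> ^ ?n) ^ K * (d * d ^ K) = c * d * ((real K + 1) * x ^ K)"
      using powr_split[of \<nu>] by (simp add: x_def d_def power_mult_distrib)
    also have "ennreal (c * d * ((real K + 1) * x ^ K)) \<le> ennreal (c * d * B)"
      using cd B by (intro ennreal_leI mult_left_mono) auto
    finally show ?thesis .
  qed
  then show ?thesis by blast
qed

text \<open>It is enough to test the radii \<open>c * \<kappa> ^ k\<close>: along them the product
  grows at least like \<open>(2 * \<kappa> powr \<mu>) ^ k\<close>, with a ratio above 1 because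
  \<open>\<mu> < lam\<close>.\<close>

lemma thicken_frontier_G_lower:
  assumes lam: "\<kappa> powr lam = 1 / 2" and \<mu>: "\<mu> < lam"
  shows "Limsup (at_right 0) (\<lambda>r. emeasure lborel (thicken (frontier G) r)
    * ennreal (r powr (\<mu> - real CARD('n)))) = \<infinity>" (is "Limsup _ ?f = _")
proof (rule ccontr)
  let ?n = "CARD('n)"
  assume "Limsup (at_right 0) ?f \<noteq> \<infinity>"
  then obtain m :: nat where "Limsup (at_right 0) ?f < of_nat m"
    using ennreal_Ex_less_of_nat[of "Limsup (at_right 0) ?f"] by (auto simp: less_top)
  then obtain b :: real where b: "Limsup (at_right 0) ?f < ennreal b" "0 \<le> b"
    by (intro that[of "real m"]) (auto simp: ennreal_of_nat_eq_real_of_nat)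
  from Limsup_lessD[OF this(1)] obtain r0 where r0: "r0 > 0" "\<And>r. 0 < r \<Longrightarrow> r < r0 \<Longrightarrow> ?f r < ennreal b"
    by (auto simp: eventually_at_right_field)
  define x where "x = 2 * \<kappa> powr \<mu>"
  have "\<kappa> powr lam < \<kappa> powr \<mu>" using kappa \<mu> by (intro powr_less_mono') auto
  then have x: "1 < x" using lam by (auto simp: x_def)
  define c where "c = 4 * real ?n * \<epsilon>"
  have c: "c > 0" using card2 eps_pos by (simp add: c_def)
  define a where "a = (2 * \<epsilon>) ^ ?n * c powr (\<mu> - ?n)"
  have a: "a > 0" using c eps_pos by (simp add: a_def)
  have fk: "ennreal (a * x ^ k) \<le> ?f (c * \<kappa> ^ k)" for k
  proof -
    have "(c * \<kappa> ^ k) powr (\<mu> - ?n) = c powr (\<mu> - ?n) * (\<kappa> powr (\<mu> - ?n)) ^ k"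
      by (simp add: powr_mult kpow_powr)
    then have "a * x ^ k = (2 * \<epsilon>) ^ ?n * (2 * \<kappa> ^ ?n) ^ k * (c * \<kappa> ^ k) powr (\<mu> - ?n)"
      unfolding x_def powr_split a_def by (simp add: power_mult_distrib)
    moreover have "4 * real ?n * E k = c * \<kappa> ^ k" by (simp add: c_def E_def)
    ultimately show ?thesis
      using emeasure_thicken_frontier_G_ge[of k] eps_pos kappa
      by (simp add: ennreal_mult mult_right_mono)
  qed
  obtain k0 where k0: "b / a < x ^ k0" using real_arch_pow[OF x] by blast
  have "eventually (\<lambda>k. b / a < x ^ k) sequentially"
  proof (rule eventually_sequentiallyI)
    fix k assume "k0 \<le> k"
    then have "x ^ k0 \<le> x ^ k" using x by (intro power_increasing) auto
    then show "b / a < x ^ k" using k0 by linarith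
  qed
  moreover have "(\<lambda>k. c * \<kappa> ^ k) \<longlonglongrightarrow> c * 0"
    using kappa by (intro tendsto_intros LIMSEQ_power_zero) auto
  then have "eventually (\<lambda>k. c * \<kappa> ^ k < r0) sequentially"
    using r0(1) by (intro order_tendstoD(2)[where y = "c * 0"]) auto
  ultimately have "eventually (\<lambda>k. b / a < x ^ k \<and> c * \<kappa> ^ k < r0) sequentially"
    by (rule eventually_conj)
  then obtain k where k: "b / a < x ^ k" "c * \<kappa> ^ k < r0"
    using eventually_happens'[OF sequentially_bot] by blast
  have "b < a * x ^ k" using k(1) a by (simp add: field_simps)
  then have "ennreal b < ennreal (a * x ^ k)" using b by (simp add: ennreal_less_iff)
  also have "\<dots> \<le> ?f (c * \<kappa> ^ k)" by (rule fk)
  also have "\<dots> < ennreal b" using r0(2) c kpow_pos k(2) by simp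
  finally show False .
qed

lemma upper_minkowski_dim_frontier_G:
  assumes lam: "\<kappa> powr lam = 1 / 2" "real CARD('n) - 1 \<le> lam" "lam < real CARD('n)"
  shows "upper_minkowski_dim (frontier G) = ereal lam"
proof -
  define X where "X = {\<mu>. \<mu> \<ge> 0 \<and> Limsup (at_right 0) (\<lambda>r. emeasure lborel (thicken (frontier G) r)
    * ennreal (r powr (\<mu> - real CARD('n)))) = \<infinity>}"
  have "1 \<le> lam" using lam(2) card2 by linarith
  have dim: "upper_minkowski_dim (frontier G) = Sup (insert 0 (ereal ` X))"
    by (simp add: upper_minkowski_dim_def X_def thicken_eq_sums)
  show ?thesis unfolding dim
  proof (rule antisym)
    have "\<mu> \<le> lam" if "\<mu> \<in> X" for \<mu>
    proof (rule ccontr)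
      assume "\<not> \<mu> \<le> lam"
      with thicken_frontier_G_upper[OF lam, of \<mu>] obtain C where
        C: "\<And>r. 0 < r \<Longrightarrow> r < 1 \<Longrightarrow> emeasure lborel (thicken (frontier G) r)
          * ennreal (r powr (\<mu> - real CARD('n))) \<le> ennreal C" by auto
      have "Limsup (at_right 0) (\<lambda>r. emeasure lborel (thicken (frontier G) r)
          * ennreal (r powr (\<mu> - real CARD('n)))) \<le> ennreal C"
        by (intro Limsup_bounded) (auto simp: eventually_at_right_field intro!: exI[of _ 1] C)
      then show False using that by (simp add: X_def top_unique)
    qed
    then show "Sup (insert 0 (ereal ` X)) \<le> ereal lam"
      using \<open>1 \<le> lam\<close> by (intro Sup_least) auto
    show "ereal lam \<le> Sup (insert 0 (ereal ` X))"
    proof (rule dense_le)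
      fix y assume "y < ereal lam"
      then obtain \<mu> where \<mu>: "y < ereal \<mu>" "\<mu> < lam" "0 \<le> \<mu>"
        using \<open>1 \<le> lam\<close> ereal_dense2[of "max y 0" "ereal lam"] by auto
      then have "\<mu> \<in> X" using thicken_frontier_G_lower[OF lam(1)] by (simp add: X_def)
      then have "ereal \<mu> \<le> Sup (insert 0 (ereal ` X))" by (intro Sup_upper) auto
      then show "y \<le> Sup (insert 0 (ereal ` X))" using \<mu> by auto
    qed
  qed
qed

end

section \<open>Failure of the Poincare inequality\<close>

lemma ball_infdist_frontier_subset:
  fixes x :: "'a::euclidean_space"
  assumes "x \<in> S"
  shows "ball x (infdist x (frontier S)) \<subseteq> S"
proof (rule ccontr)
  assume "\<not> ?thesis"
  then obtain y where y: "dist x y < infdist x (frontier S)" "y \<notin> S" by (auto simp: subset_iff)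
  obtain z where "z \<in> frontier S" "dist x z \<le> dist x y" using frontier_between[OF assms y(2)] by metis
  then show False using y infdist_le[of z "frontier S" x] by linarith
qed

lemma emeasure_cball_le:
  fixes x :: "real ^ 'n"
  assumes "0 \<le> r"
  shows "emeasure lborel (cball x r) \<le> ennreal ((2 * r) ^ CARD('n))"
proof -
  have "cball x r \<subseteq> kbox x (\<lambda>_. r)"
  proof
    fix y assume "y \<in> cball x r"
    then have "norm (y - x) \<le> r" by (simp add: dist_norm norm_minus_commute)
    then show "y \<in> kbox x (\<lambda>_. r)"
      using order_trans[OF component_le_norm_cart[of "y - x"]] by (simp add: kbox_def)
  qed
  then have "emeasure lborel (cball x r) \<le> emeasure lborel (kbox x (\<lambda>_. r))" by (intro emeasure_mono) auto
  also have "\<dots> = ennreal ((2 * r) ^ CARD('n))" using assms by (subst emeasure_kbox) auto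
  finally show ?thesis .
qed

text \<open>Dyadic shells replace polar coordinates.\<close>
lemma nn_integral_dist_powr_ball:
  fixes x :: "real ^ 'n"
  assumes "0 < \<alpha>" "0 < R"
  shows "(\<integral>\<^sup>+ y. ennreal (dist x y powr (\<alpha> - real CARD('n))) * indicator (ball x R) y \<partial>lborel)
    \<le> ennreal (2 powr \<bar>\<alpha> - real CARD('n)\<bar> * 2 ^ CARD('n) / (1 - 2 powr - \<alpha>) * R powr \<alpha>)"
proof -
  let ?n = "real CARD('n)"
  define \<beta> where "\<beta> = \<alpha> - ?n"
  define \<rho> where "\<rho> m = R * (1 / 2) ^ m" for m :: nat
  \<comment> \<open>On the shell between \<open>\<rho> m / 2\<close> and \<open>\<rho> m\<close> the
    factor \<open>2 powr \<bar>\<beta>\<bar>\<close> covers both signs of \<beta>. Summing over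
    whole balls in place of shells still gives a geometric series, of ratio
    \<open>2 powr - \<alpha>\<close>.\<close>
  define c where "c m = 2 powr \<bar>\<beta>\<bar> * \<rho> m powr \<beta>" for m
  have \<rho>: "0 < \<rho> m" for m using assms by (simp add: \<rho>_def)
  have c: "0 \<le> c m" for m by (simp add: c_def)
  \<comment> \<open>At \<open>y = x\<close> the left side is 0, because
    \<open>0 powr \<beta> = 0\<close> even for negative \<beta>.\<close>
  have "ennreal (dist x y powr \<beta>) * indicator (ball x R) y \<le> (\<Sum>m. ennreal (c m) * indicator (cball x (\<rho> m)) y)" for y
  proof (cases "y = x \<or> y \<notin> ball x R")
    case False
    define r where "r = dist x y / R"
    have r: "0 < r" "r < 1" "dist x y = R * r" using False assms by (auto simp: r_def dist_commute)
    obtain m where m: "(1 / 2) ^ Suc m < r" "r \<le> (1 / 2) ^ m" using power_bracket[of "1 / 2" r] r(1,2) by auto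
    have bounds: "\<rho> m / 2 \<le> dist x y" "dist x y \<le> \<rho> m"
      using m r(3) assms by (auto simp: \<rho>_def)
    have "dist x y powr \<beta> \<le> c m"
    proof (cases "0 \<le> \<beta>")
      case True
      have "dist x y powr \<beta> \<le> \<rho> m powr \<beta>" using bounds True by (intro powr_mono2) auto
      also have "\<dots> \<le> c m" using True ge_one_powr_ge_zero[of 2 \<beta>] by (simp add: c_def mult_le_cancel_right1)
      finally show ?thesis .
    next
      case neg: False
      have "dist x y powr \<beta> \<le> (\<rho> m / 2) powr \<beta>" using bounds neg \<rho>[of m] by (intro powr_mono2') auto
      also have "\<dots> = c m" using neg \<rho>[of m] by (simp add: c_def powr_divide powr_minus field_simps)
      finally show ?thesis .
    qed
    then have "ennreal (dist x y powr \<beta>) * indicator (ball x R) y \<le> ennreal (c m) * indicator (cball x (\<rho> m)) y"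
      using False bounds(2) by (simp add: ennreal_leI)
    also have "\<dots> \<le> (\<Sum>m. ennreal (c m) * indicator (cball x (\<rho> m)) y)"
    proof -
      have "f m \<le> suminf f" for f :: "nat \<Rightarrow> ennreal"
        using sum_le_suminf[of f "{m}"] by simp
      then show ?thesis .
    qed
    finally show ?thesis .
  qed auto
  then have "(\<integral>\<^sup>+ y. ennreal (dist x y powr \<beta>) * indicator (ball x R) y \<partial>lborel)
      \<le> (\<integral>\<^sup>+ y. (\<Sum>m. ennreal (c m) * indicator (cball x (\<rho> m)) y) \<partial>lborel)"
    by (intro nn_integral_mono)
  also have "\<dots> = (\<Sum>m. \<integral>\<^sup>+ y. ennreal (c m) * indicator (cball x (\<rho> m)) y \<partial>lborel)"
    by (intro nn_integral_suminf borel_measurable_times_ennreal borel_measurable_const borel_measurable_indicator) auto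
  also have "\<dots> = (\<Sum>m. ennreal (c m) * emeasure lborel (cball x (\<rho> m)))"
    by (subst nn_integral_cmult_indicator) auto
  also have "\<dots> \<le> (\<Sum>m. ennreal (2 powr \<bar>\<beta>\<bar> * 2 ^ CARD('n) * R powr \<alpha> * (2 powr - \<alpha>) ^ m))"
  proof (intro suminf_le summableI)
    fix m
    have "ennreal (c m) * emeasure lborel (cball x (\<rho> m)) \<le> ennreal (c m) * ennreal ((2 * \<rho> m) ^ CARD('n))"
      using \<rho>[of m] by (intro mult_left_mono emeasure_cball_le) auto
    also have "\<dots> = ennreal (c m * (2 * \<rho> m) ^ CARD('n))"
      using c \<rho>[of m] by (intro ennreal_mult[symmetric]) auto
    also have "c m * (2 * \<rho> m) ^ CARD('n) = 2 powr \<bar>\<beta>\<bar> * 2 ^ CARD('n) * (\<rho> m powr \<beta> * \<rho> m powr ?n)"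
      using \<rho>[of m] by (simp add: c_def power_mult_distrib powr_realpow)
    also have "\<rho> m powr \<beta> * \<rho> m powr ?n = \<rho> m powr \<alpha>"
      by (simp add: \<beta>_def flip: powr_add)
    also have "\<dots> = R powr \<alpha> * (2 powr - \<alpha>) ^ m"
    proof -
      have "((1 / 2) ^ m) powr \<alpha> = (2 powr - \<alpha>) ^ m"
        by (induction m) (simp_all add: powr_mult powr_divide powr_minus field_simps)
      then show ?thesis using assms by (simp add: \<rho>_def powr_mult)
    qed
    finally show "ennreal (c m) * emeasure lborel (cball x (\<rho> m))
        \<le> ennreal (2 powr \<bar>\<beta>\<bar> * 2 ^ CARD('n) * R powr \<alpha> * (2 powr - \<alpha>) ^ m)"
      by (simp add: mult.assoc)
  qed
  also have "\<dots> = ennreal (\<Sum>m. 2 powr \<bar>\<beta>\<bar> * 2 ^ CARD('n) * R powr \<alpha> * (2 powr - \<alpha>) ^ m)"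
    using assms by (intro suminf_ennreal2 summable_mult summable_geometric) (auto simp: powr_less_one)
  also have "(\<Sum>m. 2 powr \<bar>\<beta>\<bar> * 2 ^ CARD('n) * R powr \<alpha> * (2 powr - \<alpha>) ^ m)
      = 2 powr \<bar>\<beta>\<bar> * 2 ^ CARD('n) * R powr \<alpha> * (1 / (1 - 2 powr - \<alpha>))"
    using assms suminf_geometric[of "2 powr - \<alpha>"]
    by (subst suminf_mult) (auto simp: powr_less_one intro!: summable_geometric)
  finally show ?thesis by (simp add: \<beta>_def mult_ac)
qed

context room_tree begin

section \<open>The bump of a single room\<close>

definition height :: "bool list \<Rightarrow> real ^ 'n \<Rightarrow> real" where
  "height w x = x $ ax (Suc (length w)) - p w $ ax (Suc (length w))"

text \<open>Rises from 0 at height \<open>E\<close>, where the tube leaves the bar, to 1 at height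
  \<open>2 * E\<close>, still below the room. It is discontinuous at the other faces of the casing,
  but these do not meet \<open>G\<close>.\<close>

definition bump :: "bool list \<Rightarrow> real ^ 'n \<Rightarrow> real" where
  "bump w x = (if x \<in> casing w then min 1 (height w x / E (length w) - 1) else 0)"

lemma height_ge: "x \<in> casing w \<Longrightarrow> E (length w) \<le> height w x"
  unfolding height_def by (rule casing_side)

lemma bump_bounds: "0 \<le> bump w x" "bump w x \<le> 1"
  using height_ge[of x w] scaled(1)[of "length w"] by (auto simp: bump_def min_def field_simps)

lemma room_height: "x \<in> room w \<Longrightarrow> 3 * E (length w) < height w x"
  using oboxD[of x "above w 4" "\<lambda>_. E (length w)" "ax (Suc (length w))"] ax_Suc_neq[of "length w"]
  by (auto simp: room_def height_def above_nth)

lemma chamber_height: "x \<in> tube w \<union> room w \<Longrightarrow> height w x \<le> 5 * E (length w)"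
  using oboxD[of x "above w 4" "\<lambda>_. E (length w)" "ax (Suc (length w))"] ax_Suc_neq[of "length w"]
    scaled[of "length w"]
  by (auto simp: room_def tube_def height_def above_nth dest!: oboxD[where l = "ax (Suc (length w))"])

lemma bump_room: "x \<in> room w \<Longrightarrow> bump w x = 1"
  using room_height[of x w] room_subset_casing[of w] scaled(1)[of "length w"]
  by (auto simp: bump_def min_def field_simps)

lemma bump_measurable [measurable]: "bump w \<in> borel_measurable borel"
proof -
  have [measurable]: "(\<lambda>x :: real ^ 'n. x $ l) \<in> borel_measurable borel" for l
    by (intro borel_measurable_continuous_onI continuous_intros)
  have [measurable]: "casing w \<in> sets borel" by (simp add: casing_def)
  show ?thesis unfolding bump_def height_def by measurable
qed

lemma bump_nonzero: "x \<in> G \<Longrightarrow> bump w x \<noteq> 0 \<Longrightarrow> x \<in> casing w \<and> x \<in> branch w"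
  using casing_Int_G[of w] by (auto simp: bump_def branch_def split: if_splits)

lemma bump_unique:
  assumes "x \<in> G" "bump v x \<noteq> 0" "bump w x \<noteq> 0"
  shows "v = w"
  using bump_nonzero[OF assms(1,2)] bump_nonzero[OF assms(1,3)] casing_Int_branch[of v w] by blast

lemma bump_bar_root: "x \<in> bar [] \<Longrightarrow> bump w x = 0"
  using casing_Int_bar[of "[]"] casing_Int_branch[of "[]" w] by (cases "w = []") (auto simp: bump_def branch_def)

text \<open>A segment in \<open>G\<close> on which the bump changes must meet the rising part.
  Either y is in the casing, and then below height \<open>2 * E\<close>, or the segment leaves the
  casing, which within \<open>G\<close> is possible only through the face at height
  \<open>E\<close>, where the bump vanishes. The point z found in this way locates the pair x, y
  near the tube.\<close>

lemma bump_diff_aux: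
  assumes seg: "closed_segment x y \<subseteq> G" and gt: "bump w y < bump w x"
  shows "bump w x - bump w y \<le> dist x y / E (length w) \<and>
    (\<exists>z\<in>closed_segment x y. z \<in> casing w \<and> height w z \<le> 2 * E (length w))"
proof -
  let ?E = "E (length w)"
  have E: "0 < ?E" by (rule scaled)
  have x: "x \<in> casing w" using gt bump_bounds(1)[of w y] by (auto simp: bump_def split: if_splits)
  have height_diff: "height w a - height w b \<le> dist a b" for a b
  proof -
    have "\<bar>(a - b) $ ax (Suc (length w))\<bar> \<le> norm (a - b)" by (rule component_le_norm_cart)
    then show ?thesis by (simp add: height_def dist_norm)
  qed
  have bx: "bump w x \<le> height w x / ?E - 1" using x by (simp add: bump_def)
  show ?thesis
  proof (cases "y \<in> casing w")
    case True
    have "bump w y < 1" using gt bump_bounds(2)[of w x] by linarith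
    then have hy: "bump w y = height w y / ?E - 1" "height w y < 2 * ?E"
      using True E by (auto simp: bump_def min_def field_simps split: if_splits)
    have "bump w x - bump w y \<le> (height w x - height w y) / ?E"
      using bx hy(1) by (simp add: diff_divide_distrib)
    also have "\<dots> \<le> dist x y / ?E" using height_diff E by (intro divide_right_mono) auto
    finally show ?thesis using True hy(2) by (intro conjI bexI[of _ y]) auto
  next
    case False
    then obtain z where z: "z \<in> frontier (casing w)" "z \<in> closed_segment x y" "dist x z \<le> dist x y"
      using frontier_between[OF x] by metis
    have zc: "z \<in> casing w" "\<exists>l. \<not> \<bar>z $ l - above w 4 $ l\<bar>
        < (if l = ax (Suc (length w)) then 3 * ?E else 2 * ?E)"
      using z(1) frontier_kbox_subset by (fastforce simp: casing_def obox_def)+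
    then obtain l where l: "\<not> \<bar>z $ l - above w 4 $ l\<bar> < (if l = ax (Suc (length w)) then 3 * ?E else 2 * ?E)" by blast
    have zG: "z \<in> tube w \<union> room w" using casing_Int_G zc(1) z(2) seg by blast
    have "\<bar>z $ l - above w 2 $ l\<bar> < (if l = ax (Suc (length w)) then 2 * ?E + W (length w) else W (length w))
        \<or> \<bar>z $ l - above w 4 $ l\<bar> < ?E"
      using zG unfolding tube_def room_def by (blast dest: oboxD[where l = l])
    \<comment> \<open>The lateral faces are \<open>2 * E\<close> from the axis of the tube and the
      top face is at height \<open>7 * E\<close>, whereas tube and room extend sideways by at most
      \<open>E\<close> and up to \<open>5 * E\<close>. Only the bottom face is left.\<close>
    then have "l = ax (Suc (length w))" "height w z \<le> ?E"
      using l chamber_height[OF zG] scaled[of "length w"] ax_Suc_neq[of "length w"]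
      by (auto simp: above_nth height_def split: if_splits)
    then have hz: "height w z = ?E" using height_ge[OF zc(1)] by simp
    have "bump w x - bump w y \<le> (height w x - height w z) / ?E"
      using bx bump_bounds(1)[of w y] hz E by (simp add: diff_divide_distrib)
    also have "\<dots> \<le> dist x z / ?E" using height_diff E by (intro divide_right_mono) auto
    also have "\<dots> \<le> dist x y / ?E" using z E by (intro divide_right_mono) auto
    finally show ?thesis using z zc hz E by (intro conjI bexI[of _ z]) auto
  qed
qed

lemma bump_diff:
  assumes seg: "closed_segment x y \<subseteq> G" and neq: "bump w x \<noteq> bump w y"
  shows "\<bar>bump w x - bump w y\<bar> \<le> dist x y / E (length w)"
    "\<exists>z\<in>closed_segment x y. z \<in> casing w \<and> height w z \<le> 2 * E (length w)"
  using bump_diff_aux[of x y w] bump_diff_aux[of y x w] seg neq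
  by (cases "bump w y < bump w x"; simp add: closed_segment_commute dist_commute)+

section \<open>Localization at the thin part of the tubes\<close>

lemma tube_near_frontier:
  assumes z: "z \<in> G" "z \<in> casing w" "height w z \<le> 2 * E (length w)"
  shows "z \<in> tube w" "infdist z (frontier G) \<le> 2 * W (length w)"
proof -
  let ?i = "ax (length w)" and ?k = "length w"
  show tube: "z \<in> tube w" using casing_Int_G[of w] z room_height[of z w] scaled(1)[of ?k] by auto
  have zi: "\<bar>z $ ?i - above w 4 $ ?i\<bar> < W ?k"
    using oboxD[OF tube[unfolded tube_def], of ?i] ax_Suc_neq[of ?k] by (auto simp: above_nth split: if_splits)
  \<comment> \<open>z is moved along the bar's axis to the side wall of the tube. The new point is
    still in the casing, and below the room because its height is unchanged, hence outside
    \<open>G\<close>.\<close>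
  define t where "t = above w 4 $ ?i + W ?k - z $ ?i"
  define y where "y = z + t *\<^sub>R axis ?i 1"
  have y: "y $ l = (if l = ?i then above w 4 $ ?i + W ?k else z $ l)" for l
    by (auto simp: y_def t_def axis_def)
  have "y \<in> casing w"
    unfolding casing_def kbox_def
  proof clarify
    fix l
    show "\<bar>y $ l - above w 4 $ l\<bar> \<le> (if l = ax (Suc ?k) then 3 * E ?k else 2 * E ?k)"
      using kboxD[OF z(2)[unfolded casing_def], of l] y[of l] scaled[of ?k] ax_Suc_neq[of ?k] by auto
  qed
  moreover have "y \<notin> tube w"
    using y[of ?i] scaled[of ?k] ax_Suc_neq[of ?k]
    by (auto simp: tube_def above_nth dest!: oboxD[where l = ?i])
  moreover have "y \<notin> room w"
    using room_height[of y w] z(3) y[of "ax (Suc ?k)"] ax_Suc_neq[of ?k] scaled(1)[of ?k] by (auto simp: height_def)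
  ultimately have "y \<notin> G" using casing_Int_G[of w] by blast
  then obtain f where f: "f \<in> frontier G" "dist z f \<le> dist z y" using frontier_between[OF z(1)] by metis
  have "dist z y = \<bar>t\<bar>" by (simp add: y_def dist_norm)
  also have "\<dots> \<le> 2 * W ?k" using zi by (simp add: t_def)
  finally show "infdist z (frontier G) \<le> 2 * W ?k" using f infdist_le[of f "frontier G" z] by linarith
qed

text \<open>The rising part of the bump lies between heights \<open>E\<close> and
  \<open>2 * E\<close>; the box around height \<open>E\<close> covers it together with everything
  within \<open>R\<close>.\<close>

definition slab :: "real \<Rightarrow> bool list \<Rightarrow> (real ^ 'n) set" where
  "slab R w = kbox (above w 1) (\<lambda>l. if l = ax (Suc (length w)) then E (length w) + R else W (length w) + R)"

text \<open>Here \<open>\<tau> < 1\<close> is decisive. With d the boundary distance of x, the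
  segment from x to y contains a point within \<open>2 * W\<close> of the boundary and less than
  \<open>\<tau> * d\<close> away from x; so \<open>d \<le> 2 * W + \<tau> * d\<close>, and d is
  comparable to the tube's width.\<close>

lemma bump_local:
  assumes \<tau>: "0 < \<tau>" "\<tau> < 1" and x: "x \<in> G" and y: "y \<in> ball x (\<tau> * infdist x (frontier G))"
    and neq: "bump w x \<noteq> bump w y" and R: "R = 2 * W (length w) / (1 - \<tau>)"
  shows "\<bar>bump w x - bump w y\<bar> \<le> dist x y / E (length w)" "x \<in> slab R w" "y \<in> ball x R"
proof -
  define d where "d = infdist x (frontier G)"
  have d: "0 \<le> d" by (simp add: d_def infdist_nonneg)
  have yd: "dist x y < \<tau> * d" using y by (simp add: d_def)
  have td: "\<tau> * d \<le> d" using \<tau> d mult_right_mono[of \<tau> 1 d] by simp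
  have "y \<in> ball x d" using yd td by simp
  moreover have "0 < d" using yd td zero_le_dist[of x y] by linarith
  then have "x \<in> ball x d" by simp
  ultimately have "closed_segment x y \<subseteq> ball x d" by (intro closed_segment_subset) auto
  also have "\<dots> \<subseteq> G" unfolding d_def by (rule ball_infdist_frontier_subset[OF x])
  finally have seg: "closed_segment x y \<subseteq> G" .
  show "\<bar>bump w x - bump w y\<bar> \<le> dist x y / E (length w)" by (rule bump_diff[OF seg neq])
  obtain z where z: "z \<in> closed_segment x y" "z \<in> casing w" "height w z \<le> 2 * E (length w)"
    using bump_diff(2)[OF seg neq] by blast
  have tube: "z \<in> tube w" "infdist z (frontier G) \<le> 2 * W (length w)"
    using tube_near_frontier[OF _ z(2,3)] z(1) seg by auto
  have xz: "dist x z \<le> dist x y"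
    using segment_bound(1)[OF z(1)] by (simp add: dist_norm norm_minus_commute)
  have "d \<le> infdist z (frontier G) + dist x z" unfolding d_def by (rule infdist_triangle)
  then have "d \<le> 2 * W (length w) + \<tau> * d" using tube(2) xz yd by linarith
  then have "d \<le> R" unfolding R using \<tau> by (simp add: field_simps)
  then have yR: "dist x y < R" using yd td by linarith
  then show "y \<in> ball x R" by simp
  show "x \<in> slab R w" unfolding slab_def kbox_def
  proof clarify
    fix l
    have xl: "\<bar>x $ l - z $ l\<bar> \<le> R"
      using component_le_norm_cart[of "x - z" l] xz yR by (simp add: dist_norm)
    have zl: "\<bar>z $ l - above w 2 $ l\<bar> < (if l = ax (Suc (length w)) then 2 * E (length w) + W (length w) else W (length w))"
      using oboxD[OF tube(1)[unfolded tube_def], of l] by simp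
    show "\<bar>x $ l - above w 1 $ l\<bar> \<le> (if l = ax (Suc (length w)) then E (length w) + R else W (length w) + R)"
    proof (cases "l = ax (Suc (length w))")
      case True
      then have "\<bar>z $ l - above w 1 $ l\<bar> \<le> E (length w)"
        using height_ge[OF z(2)] z(3) ax_Suc_neq[of "length w"] scaled(1)[of "length w"]
        by (auto simp: height_def above_nth)
      then show ?thesis using True xl by simp
    next
      case False
      then have "above w 1 $ l = above w 2 $ l" by (simp add: above_nth)
      then show ?thesis using False xl zl by simp
    qed
  qed
qed

lemma emeasure_slab:
  assumes \<rho>: "0 \<le> \<rho>" and R: "R = \<rho> * W (length w)"
  shows "emeasure lborel (slab R w) \<le> ennreal ((2 * (1 + \<rho>)) ^ CARD('n) * (E (length w) * W (length w) ^ (CARD('n) - 1)))"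
proof -
  let ?k = "length w" and ?j = "ax (Suc (length w))"
  have pos: "0 < W ?k" "W ?k \<le> E ?k" "0 < E ?k" "0 \<le> R" using scaled[of ?k] \<rho> R by auto
  have "emeasure lborel (slab R w) = ennreal (\<Prod>l\<in>UNIV. 2 * (if l = ?j then E ?k + R else W ?k + R))"
    unfolding slab_def using pos by (intro emeasure_kbox) auto
  also have "(\<Prod>l\<in>UNIV. 2 * (if l = ?j then E ?k + R else W ?k + R))
      = 2 * (E ?k + R) * (\<Prod>l\<in>UNIV - {?j}. 2 * (W ?k + R))"
    by (subst prod.remove[of _ ?j]) (auto intro!: prod.cong)
  also have "\<dots> = 2 * (E ?k + R) * (2 * (W ?k + R)) ^ (CARD('n) - 1)"
    by (simp add: card_Diff_singleton)
  also have "2 * (W ?k + R) = 2 * (1 + \<rho>) * W ?k" by (simp add: R algebra_simps)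
  also have "ennreal (2 * (E ?k + R) * (2 * (1 + \<rho>) * W ?k) ^ (CARD('n) - 1))
      \<le> ennreal (2 * ((1 + \<rho>) * E ?k) * (2 * (1 + \<rho>) * W ?k) ^ (CARD('n) - 1))"
  proof (intro ennreal_leI mult_right_mono mult_left_mono)
    show "E ?k + R \<le> (1 + \<rho>) * E ?k" using \<rho> pos by (simp add: R algebra_simps mult_left_mono)
  qed (use \<rho> pos in auto)
  also have "2 * ((1 + \<rho>) * E ?k) * (2 * (1 + \<rho>) * W ?k) ^ (CARD('n) - 1)
      = (2 * (1 + \<rho>)) ^ Suc (CARD('n) - 1) * (E ?k * W ?k ^ (CARD('n) - 1))"
  proof -
    have "2 * (b * e) * (2 * b * v) ^ m = (2 * b) ^ Suc m * (e * v ^ m)" for b e v :: real and m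
      by (simp add: power_mult_distrib)
    then show ?thesis .
  qed
  also have "Suc (CARD('n) - 1) = CARD('n)" using card2 by simp
  finally show ?thesis .
qed

end

definition short_words :: "nat \<Rightarrow> bool list set" where
  "short_words K = (\<Union>k<K. words k)"

lemma finite_short_words [simp]: "finite (short_words K)"
  by (simp add: short_words_def)

lemma sum_short_words:
  fixes f :: "nat \<Rightarrow> real"
  shows "(\<Sum>w\<in>short_words K. f (length w)) = (\<Sum>k<K. 2 ^ k * f k)"
proof -
  have "(\<Sum>w\<in>short_words K. f (length w)) = (\<Sum>k<K. \<Sum>w\<in>words k. f (length w))"
    unfolding short_words_def by (rule sum.UNION_disjoint) (auto, auto simp: words_def)
  also have "\<dots> = (\<Sum>k<K. \<Sum>w\<in>words k. f k)" by (intro sum.cong) (auto simp: words_def)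
  finally show ?thesis by (simp add: card_words)
qed

context room_tree begin

section \<open>The test function on finitely many levels\<close>

definition weight :: "real \<Rightarrow> nat \<Rightarrow> real" where
  "weight lam k = (\<kappa> ^ k) powr (lam - real CARD('n))"

definition test_fun :: "real \<Rightarrow> nat \<Rightarrow> real ^ 'n \<Rightarrow> real" where
  "test_fun lam K x = (\<Sum>w\<in>short_words K. weight lam (length w) * bump w x)"

lemma weight_pos: "0 < weight lam k"
  using kappa by (simp add: weight_def)

lemma test_fun_nonneg: "0 \<le> test_fun lam K x"
  unfolding test_fun_def by (intro sum_nonneg mult_nonneg_nonneg bump_bounds less_imp_le weight_pos)

lemma test_fun_le: "test_fun lam K x \<le> (\<Sum>w\<in>short_words K. weight lam (length w))"
  unfolding test_fun_def using bump_bounds weight_pos[THEN less_imp_le]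
  by (intro sum_mono mult_left_le) auto

lemma test_fun_measurable [measurable]: "test_fun lam K \<in> borel_measurable borel"
  unfolding test_fun_def by measurable

lemma test_fun_bar_root: "x \<in> bar [] \<Longrightarrow> test_fun lam K x = 0"
  by (simp add: test_fun_def bump_bar_root)

text \<open>At most one bump is nonzero at a point of \<open>G\<close>, so the value at x is a
  single term, while all terms at y are nonnegative. One room thus controls the difference, without
  a constant that grows with \<open>K\<close>.\<close>

lemma test_fun_diff_aux:
  assumes "x \<in> G" "test_fun lam K y < test_fun lam K x"
  shows "\<exists>w\<in>short_words K. test_fun lam K x - test_fun lam K y \<le> weight lam (length w) * (bump w x - bump w y)"
proof -
  have "test_fun lam K x \<noteq> 0" using assms(2) test_fun_nonneg[of lam K y] by linarith
  then obtain w where w: "w \<in> short_words K" "bump w x \<noteq> 0"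
    unfolding test_fun_def by (metis (no_types, lifting) mult_zero_right sum.neutral)
  have "test_fun lam K x = weight lam (length w) * bump w x
      + (\<Sum>v\<in>short_words K - {w}. weight lam (length v) * bump v x)"
    unfolding test_fun_def using w by (intro sum.remove) auto
  also have "(\<Sum>v\<in>short_words K - {w}. weight lam (length v) * bump v x) = 0"
    using bump_unique[OF assms(1) _ w(2)] by (intro sum.neutral) auto
  finally have x: "test_fun lam K x = weight lam (length w) * bump w x" by simp
  have "weight lam (length w) * bump w y \<le> test_fun lam K y"
    unfolding test_fun_def using w bump_bounds weight_pos[THEN less_imp_le]
    by (intro member_le_sum[where f = "\<lambda>w. weight lam (length w) * bump w y"]) auto
  then show ?thesis using x w(1) by (intro bexI[of _ w]) (auto simp: algebra_simps)
qed

lemma test_fun_diff: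
  assumes "x \<in> G" "y \<in> G" "test_fun lam K x \<noteq> test_fun lam K y"
  shows "\<exists>w\<in>short_words K. bump w x \<noteq> bump w y \<and>
    \<bar>test_fun lam K x - test_fun lam K y\<bar> \<le> weight lam (length w) * \<bar>bump w x - bump w y\<bar>"
proof -
  have *: "\<exists>w\<in>short_words K. bump w a \<noteq> bump w b \<and>
      \<bar>test_fun lam K a - test_fun lam K b\<bar> \<le> weight lam (length w) * \<bar>bump w a - bump w b\<bar>"
    if ab: "a \<in> G" "test_fun lam K b < test_fun lam K a" for a b
  proof -
    obtain w where w: "w \<in> short_words K"
      "test_fun lam K a - test_fun lam K b \<le> weight lam (length w) * (bump w a - bump w b)"
      using test_fun_diff_aux[OF ab] by blast
    have "weight lam (length w) * (bump w a - bump w b) \<le> weight lam (length w) * \<bar>bump w a - bump w b\<bar>"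
      using weight_pos[THEN less_imp_le] by (intro mult_left_mono) auto
    then show ?thesis using w ab(2) by (intro bexI[of _ w]) auto
  qed
  show ?thesis
  proof (cases "test_fun lam K y < test_fun lam K x")
    case True
    then show ?thesis using *[OF assms(1)] by blast
  next
    case False
    then have "test_fun lam K x < test_fun lam K y" using assms by linarith
    from *[OF assms(2) this] show ?thesis by (simp add: abs_minus_commute eq_commute)
  qed
qed

section \<open>The energy of the test function\<close>

definition energy :: "real \<Rightarrow> real \<Rightarrow> real \<Rightarrow> (real ^ 'n \<Rightarrow> real) \<Rightarrow> ennreal" where
  "energy P \<delta> \<tau> u = (\<integral>\<^sup>+ x. (\<integral>\<^sup>+ y.
      ennreal (\<bar>u x - u y\<bar> powr P / dist x y powr (real CARD('n) + \<delta> * P))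
        * indicator (G \<inter> ball x (\<tau> * infdist x (frontier G))) y \<partial>lborel) * indicator G x \<partial>lborel)"

text \<open>Near one tube the test function varies at rate \<open>weight / E\<close>, so the
  integrand is at most the P-th power of this rate times
  \<open>dist x y powr (\<alpha> - real CARD('n))\<close>, which is integrable because
  \<open>\<alpha> > 0\<close>. The inner integral over a ball of radius \<open>\<rho> * W\<close>
  gives \<open>(\<rho> * W) powr \<alpha>\<close>, the outer one the volume of the slab.\<close>

lemma energy_test_fun_sum:
  assumes P: "1 < P" and \<delta>: "0 < \<delta>" "\<delta> < 1" and \<tau>: "0 < \<tau>" "\<tau> < 1"
  defines "\<alpha> \<equiv> P * (1 - \<delta>)" and "\<rho> \<equiv> 2 / (1 - \<tau>)"
  defines "C \<equiv> 2 powr \<bar>\<alpha> - real CARD('n)\<bar> * 2 ^ CARD('n) / (1 - 2 powr - \<alpha>)"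
  shows "energy P \<delta> \<tau> (test_fun lam K) \<le> ennreal (\<Sum>w\<in>short_words K.
    (weight lam (length w) / E (length w)) powr P * (C * (\<rho> * W (length w)) powr \<alpha>)
      * ((2 * (1 + \<rho>)) ^ CARD('n) * (E (length w) * W (length w) ^ (CARD('n) - 1))))"
proof -
  let ?u = "test_fun lam K" and ?n = "real CARD('n)"
  define a where "a w = (weight lam (length w) / E (length w)) powr P" for w :: "bool list"
  define R where "R w = \<rho> * W (length w)" for w :: "bool list"
  have \<alpha>: "0 < \<alpha>" using P \<delta> by (simp add: \<alpha>_def)
  have \<rho>: "0 < \<rho>" using \<tau> by (simp add: \<rho>_def)
  have R: "0 < R w" "R w = 2 * W (length w) / (1 - \<tau>)" for w
    using \<rho> W_pos by (auto simp: R_def \<rho>_def)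
  have C: "0 \<le> C" using \<alpha> by (auto simp: C_def powr_less_one intro!: divide_nonneg_pos)
  have a: "0 \<le> a w" for w by (simp add: a_def)
  have [measurable]: "slab r w \<in> sets borel" "ball x r \<in> sets borel" for r w x
    by (simp_all add: slab_def)
  have pointwise: "ennreal (\<bar>?u x - ?u y\<bar> powr P / dist x y powr (?n + \<delta> * P))
        * indicator (G \<inter> ball x (\<tau> * infdist x (frontier G))) y
      \<le> (\<Sum>w\<in>short_words K. ennreal (a w) * indicator (slab (R w) w) x
          * (ennreal (dist x y powr (\<alpha> - ?n)) * indicator (ball x (R w)) y))"
      (is "_ \<le> (\<Sum>w\<in>_. ?t w)") if x: "x \<in> G" for x y
  proof (cases "y \<in> G \<inter> ball x (\<tau> * infdist x (frontier G)) \<and> ?u x \<noteq> ?u y")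
    case True
    then have y: "y \<in> G" "y \<in> ball x (\<tau> * infdist x (frontier G))" and ne: "?u x \<noteq> ?u y" by auto
    obtain w where w: "w \<in> short_words K" "bump w x \<noteq> bump w y"
      "\<bar>?u x - ?u y\<bar> \<le> weight lam (length w) * \<bar>bump w x - bump w y\<bar>"
      using test_fun_diff[OF x y(1) ne] by blast
    note local = bump_local[OF \<tau> x y(2) w(2) R(2)]
    have d: "0 < dist x y" using ne by auto
    have "\<bar>?u x - ?u y\<bar> \<le> weight lam (length w) * (dist x y / E (length w))"
      using w(3) mult_left_mono[OF local(1) weight_pos[THEN less_imp_le]] by (rule order_trans)
    also have "\<dots> = (weight lam (length w) / E (length w)) * dist x y" by simp
    finally have "\<bar>?u x - ?u y\<bar> powr P \<le> (weight lam (length w) / E (length w) * dist x y) powr P"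
      using P by (intro powr_mono2) auto
    also have "\<dots> = a w * dist x y powr P"
      unfolding a_def using weight_pos[of lam "length w"] scaled(1)[of "length w"] by (intro powr_mult)
    finally have "\<bar>?u x - ?u y\<bar> powr P / dist x y powr (?n + \<delta> * P)
        \<le> a w * dist x y powr P / dist x y powr (?n + \<delta> * P)" by (intro divide_right_mono) auto
    also have "\<dots> = a w * dist x y powr (P - (?n + \<delta> * P))" using d by (simp add: powr_diff)
    also have "P - (?n + \<delta> * P) = \<alpha> - ?n" by (simp add: \<alpha>_def algebra_simps)
    finally have "ennreal (\<bar>?u x - ?u y\<bar> powr P / dist x y powr (?n + \<delta> * P))
        \<le> ennreal (a w) * ennreal (dist x y powr (\<alpha> - ?n))"
      using a by (simp add: ennreal_leI flip: ennreal_mult)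
    then have "ennreal (\<bar>?u x - ?u y\<bar> powr P / dist x y powr (?n + \<delta> * P))
        * indicator (G \<inter> ball x (\<tau> * infdist x (frontier G))) y \<le> ?t w"
      using True local(2,3) by simp
    also have "\<dots> \<le> (\<Sum>w\<in>short_words K. ?t w)" using w(1) by (intro member_le_sum) auto
    finally show ?thesis .
  qed (auto split: split_indicator)
  have inner: "(\<integral>\<^sup>+ y. ennreal (\<bar>?u x - ?u y\<bar> powr P / dist x y powr (?n + \<delta> * P))
        * indicator (G \<inter> ball x (\<tau> * infdist x (frontier G))) y \<partial>lborel)
      \<le> (\<Sum>w\<in>short_words K. ennreal (a w) * indicator (slab (R w) w) x * ennreal (C * R w powr \<alpha>))"
      (is "?I x \<le> _") if x: "x \<in> G" for x
  proof -
    have "?I x \<le> (\<integral>\<^sup>+ y. (\<Sum>w\<in>short_words K. ennreal (a w) * indicator (slab (R w) w) x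
          * (ennreal (dist x y powr (\<alpha> - ?n)) * indicator (ball x (R w)) y)) \<partial>lborel)"
      by (intro nn_integral_mono pointwise x)
    also have "\<dots> = (\<Sum>w\<in>short_words K. ennreal (a w) * indicator (slab (R w) w) x
          * (\<integral>\<^sup>+ y. ennreal (dist x y powr (\<alpha> - ?n)) * indicator (ball x (R w)) y \<partial>lborel))"
      by (subst nn_integral_sum, measurable) (intro sum.cong refl nn_integral_cmult, measurable)
    also have "\<dots> \<le> (\<Sum>w\<in>short_words K. ennreal (a w) * indicator (slab (R w) w) x * ennreal (C * R w powr \<alpha>))"
      unfolding C_def using \<alpha> R by (intro sum_mono mult_left_mono nn_integral_dist_powr_ball) auto
    finally show ?thesis .
  qed
  have "energy P \<delta> \<tau> ?u \<le> (\<integral>\<^sup>+ x. (\<Sum>w\<in>short_words K.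
      ennreal (a w * (C * R w powr \<alpha>)) * indicator (slab (R w) w) x) \<partial>lborel)"
    unfolding energy_def
  proof (rule nn_integral_mono)
    fix x
    show "?I x * indicator G x
        \<le> (\<Sum>w\<in>short_words K. ennreal (a w * (C * R w powr \<alpha>)) * indicator (slab (R w) w) x)"
      using inner[of x] a C by (auto simp: ennreal_mult mult_ac split: split_indicator)
  qed
  also have "\<dots> = (\<Sum>w\<in>short_words K. \<integral>\<^sup>+ x. ennreal (a w * (C * R w powr \<alpha>)) * indicator (slab (R w) w) x \<partial>lborel)"
    by (rule nn_integral_sum) measurable
  also have "\<dots> = (\<Sum>w\<in>short_words K. ennreal (a w * (C * R w powr \<alpha>)) * emeasure lborel (slab (R w) w))"
    by (intro sum.cong refl nn_integral_cmult_indicator) measurable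
  also have "\<dots> \<le> (\<Sum>w\<in>short_words K. ennreal (a w * (C * R w powr \<alpha>))
      * ennreal ((2 * (1 + \<rho>)) ^ CARD('n) * (E (length w) * W (length w) ^ (CARD('n) - 1))))"
    using \<rho> by (intro sum_mono mult_left_mono emeasure_slab) (auto simp: R_def)
  also have "\<dots> = (\<Sum>w\<in>short_words K. ennreal (a w * (C * R w powr \<alpha>)
      * ((2 * (1 + \<rho>)) ^ CARD('n) * (E (length w) * W (length w) ^ (CARD('n) - 1)))))"
    using a C \<rho> scaled(1) W_pos by (intro sum.cong refl ennreal_mult[symmetric]) (auto simp: less_imp_le)
  also have "\<dots> = ennreal (\<Sum>w\<in>short_words K. a w * (C * R w powr \<alpha>)
      * ((2 * (1 + \<rho>)) ^ CARD('n) * (E (length w) * W (length w) ^ (CARD('n) - 1))))"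
    using a C \<rho> scaled(1) W_pos by (intro sum_ennreal) (auto simp: less_imp_le)
  finally show ?thesis by (simp add: a_def R_def)
qed

lemma energy_test_fun_le:
  assumes lam: "\<kappa> powr lam = 1 / 2"
    and P: "1 < P" and \<delta>: "0 < \<delta>" "\<delta> < 1" and \<tau>: "0 < \<tau>" "\<tau> < 1"
    and crit: "P * (real CARD('n) + 1 - lam - s * (1 - \<delta>)) \<le> s * (real CARD('n) - 1) - lam + 1"
  shows "\<exists>C\<ge>0. \<forall>K. energy P \<delta> \<tau> (test_fun lam K) \<le> ennreal (real K * C)"
proof -
  let ?n = "real CARD('n)"
  define \<alpha> where "\<alpha> = P * (1 - \<delta>)"
  define \<rho> where "\<rho> = 2 / (1 - \<tau>)"
  define C where "C = 2 powr \<bar>\<alpha> - ?n\<bar> * 2 ^ CARD('n) / (1 - 2 powr - \<alpha>)"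
  have \<alpha>: "0 < \<alpha>" using P \<delta> by (simp add: \<alpha>_def)
  have \<rho>: "0 < \<rho>" using \<tau> by (simp add: \<rho>_def)
  have C: "0 \<le> C" using \<alpha> by (auto simp: C_def powr_less_one intro!: divide_nonneg_pos)
  define f where "f k = (weight lam k / E k) powr P * (C * (\<rho> * W k) powr \<alpha>)
      * ((2 * (1 + \<rho>)) ^ CARD('n) * (E k * W k ^ (CARD('n) - 1)))" for k
  define B where "B = \<epsilon> powr - P * (C * (\<rho> * \<epsilon>) powr \<alpha>) * ((2 * (1 + \<rho>)) ^ CARD('n) * (\<epsilon> * \<epsilon> ^ (CARD('n) - 1)))"
  have B: "0 \<le> B" using C \<rho> eps_pos by (simp add: B_def)
  \<comment> \<open>The exponent of \<open>\<kappa> ^ k\<close> in the energy of level k. The terms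
    come, in this order, from the number \<open>2 ^ k\<close> of rooms, the rate of change to the
    power P, the inner integral, and the length and the cross-section of the slab. The assumption
    \<open>crit\<close> is the same as \<open>0 \<le> e\<close>.\<close>
  define e where "e = - lam + (P * (lam - ?n) - P) + s * \<alpha> + 1 + s * (?n - 1)"
  have e: "0 \<le> e" using crit by (simp add: e_def \<alpha>_def algebra_simps)
  have fB: "2 ^ k * f k \<le> B" for k
  proof -
    define X where "X = \<kappa> ^ k"
    have X: "0 < X" "X \<le> 1" using kpow_pos[of k] kpow_le_1[of k] by (auto simp: X_def)
    have "X powr lam = (1 / 2) ^ k" unfolding X_def kpow_powr lam by simp
    then have two: "2 ^ k = X powr - lam" by (simp add: powr_minus power_one_over)
    have "X powr (lam - ?n - 1) = X powr (lam - ?n) / X"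
      using X by (simp add: powr_diff[of X "lam - ?n" 1])
    then have "weight lam k / E k = inverse \<epsilon> * X powr (lam - ?n - 1)"
      by (simp add: weight_def E_def X_def[symmetric] divide_inverse)
    then have 1: "(weight lam k / E k) powr P = \<epsilon> powr - P * X powr (P * (lam - ?n) - P)"
      using X eps_pos by (simp add: powr_mult powr_powr powr_minus inverse_powr algebra_simps)
    have 2: "(\<rho> * W k) powr \<alpha> = (\<rho> * \<epsilon>) powr \<alpha> * X powr (s * \<alpha>)"
      using X eps_pos \<rho> by (simp add: W_def X_def[symmetric] powr_mult powr_powr mult_ac)
    have "(X powr s) ^ (CARD('n) - 1) = X powr (s * (?n - 1))"
    proof -
      have "?n - 1 = real (CARD('n) - 1)" using card2 by (simp add: of_nat_diff)
      moreover have "(X powr s) ^ (CARD('n) - 1) = (X powr s) powr real (CARD('n) - 1)"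
        using X by (intro powr_realpow[symmetric]) simp
      ultimately show ?thesis by (simp only: powr_powr)
    qed
    then have 3: "E k * W k ^ (CARD('n) - 1) = \<epsilon> * \<epsilon> ^ (CARD('n) - 1) * (X powr 1 * X powr (s * (?n - 1)))"
      using X by (simp add: E_def W_def X_def[symmetric] power_mult_distrib)
    have "X powr e = X powr - lam * X powr (P * (lam - ?n) - P) * X powr (s * \<alpha>) * X powr 1 * X powr (s * (?n - 1))"
      unfolding e_def by (simp only: powr_add)
    then have "2 ^ k * f k = B * X powr e"
      unfolding f_def 1 2 3 two B_def by (simp only: mult_ac)
    also have "\<dots> \<le> B * 1"
      using X e powr_mono'[of 0 e X] B by (intro mult_left_mono) auto
    finally show ?thesis by simp
  qed
  have "energy P \<delta> \<tau> (test_fun lam K) \<le> ennreal (real K * B)" for K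
  proof -
    have "energy P \<delta> \<tau> (test_fun lam K) \<le> ennreal (\<Sum>w\<in>short_words K. f (length w))"
      unfolding f_def C_def \<alpha>_def \<rho>_def using energy_test_fun_sum[OF P \<delta> \<tau>] .
    also have "(\<Sum>w\<in>short_words K. f (length w)) = (\<Sum>k<K. 2 ^ k * f k)" by (rule sum_short_words)
    also have "ennreal \<dots> \<le> ennreal (real K * B)"
      using sum_mono[of "{..<K}" "\<lambda>k. 2 ^ k * f k" "\<lambda>_. B"] fB by (intro ennreal_leI) simp
    finally show ?thesis .
  qed
  then show ?thesis using B by blast
qed

section \<open>The mean of the test function and the contradiction\<close>

lemma finite_emeasure_G: "emeasure lborel G < \<infinity>"
  using emeasure_bounded_finite[OF bounded_G] by simp

lemma G_sets [measurable]: "G \<in> sets borel"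
  using open_G by (rule borel_open)

lemma bar_root_positive: "0 < measure lborel (bar [])" "measure lborel (bar []) \<le> measure lborel G"
proof -
  have "emeasure lborel (bar []) = ennreal (\<Prod>l\<in>UNIV. 2 * (if l = ax 0 then 1 + E 0 else E 0))"
    unfolding bar_def list.size power_0 using scaled(1)[of 0] by (intro emeasure_obox) auto
  moreover have "0 < (\<Prod>l\<in>UNIV. 2 * (if l = ax 0 then 1 + E 0 else E 0))"
    using scaled(1)[of 0] by (intro prod_pos) auto
  ultimately show "0 < measure lborel (bar [])" by (simp add: measure_def)
  show "measure lborel (bar []) \<le> measure lborel G"
    using finite_emeasure_G branch_subset_G(2)[of "[]"]
    by (intro measure_mono_fmeasurable) (auto simp: fmeasurable_def bar_def)
qed

lemma in_Lp_test_fun: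
  assumes "0 < P"
  shows "in_Lp P G (test_fun lam K)"
  unfolding in_Lp_def nn_integral_completion
proof
  show "(\<lambda>x. indicator G x * test_fun lam K x) \<in> borel_measurable lebesgue"
    by (intro measurable_completion) simp
  define M where "M = (\<Sum>w\<in>short_words K. weight lam (length w))"
  have "(\<integral>\<^sup>+ x. ennreal (\<bar>test_fun lam K x\<bar> powr P) * indicator G x \<partial>lborel)
      \<le> (\<integral>\<^sup>+ x. ennreal (M powr P) * indicator G x \<partial>lborel)"
    using assms test_fun_nonneg test_fun_le
    by (intro nn_integral_mono mult_right_mono ennreal_leI powr_mono2) (auto simp: M_def)
  also have "\<dots> < \<infinity>"
    using finite_emeasure_G by (simp add: nn_integral_cmult_indicator ennreal_mult_less_top)
  finally show "(\<integral>\<^sup>+ x. ennreal (\<bar>test_fun lam K x\<bar> powr P) * indicator G x \<partial>lborel) < \<infinity>" .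
qed

lemma mean_test_fun_ge:
  assumes lam: "\<kappa> powr lam = 1 / 2"
  shows "real K * (2 * \<epsilon>) ^ CARD('n) / measure lborel G \<le> mean_over G (test_fun lam K)"
proof -
  let ?u = "test_fun lam K"
  define M where "M = (\<Sum>w\<in>short_words K. weight lam (length w))"
  have room: "emeasure lborel (room w) < \<infinity>" "measure lborel (room w) = (2 * E (length w)) ^ CARD('n)" for w
    using emeasure_room[of w] scaled(1)[of "length w"] by (auto simp: measure_def)
  have [measurable]: "room w \<in> sets borel" for w by (simp add: room_def)
  have "integrable lborel (\<lambda>x. indicator G x * ?u x)"
  proof (rule Bochner_Integration.integrable_bound)
    show "integrable lborel (\<lambda>x. M * indicator G x)" using finite_emeasure_G by simp
    show "AE x in lborel. norm (indicator G x * ?u x) \<le> norm (M * indicator G x)"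
      using test_fun_nonneg test_fun_le order_trans[OF test_fun_nonneg test_fun_le]
      by (auto simp: M_def split: split_indicator)
  qed simp
  moreover have "integrable lborel (\<lambda>x. \<Sum>w\<in>short_words K. weight lam (length w) * indicator (room w) x)"
    using room by (intro Bochner_Integration.integrable_sum integrable_mult_right integrable_real_indicator) auto
  moreover have "(\<Sum>w\<in>short_words K. weight lam (length w) * indicator (room w) x) \<le> indicator G x * ?u x" for x
  proof (cases "x \<in> G")
    case True
    have "indicator (room w) x \<le> bump w x" for w
      using bump_room bump_bounds by (simp split: split_indicator)
    then have "(\<Sum>w\<in>short_words K. weight lam (length w) * indicator (room w) x) \<le> ?u x"
      unfolding test_fun_def using weight_pos[THEN less_imp_le] by (intro sum_mono mult_left_mono) auto
    then show ?thesis using True by simp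
  next
    case False
    then have "x \<notin> room w" for w using branch_subset_G(4) by blast
    then show ?thesis using False by simp
  qed
  ultimately have "(\<integral>x. (\<Sum>w\<in>short_words K. weight lam (length w) * indicator (room w) x) \<partial>lborel)
      \<le> (\<integral>x. indicator G x * ?u x \<partial>lborel)" by (intro integral_mono) auto
  also have "(\<integral>x. (\<Sum>w\<in>short_words K. weight lam (length w) * indicator (room w) x) \<partial>lborel)
      = (\<Sum>w\<in>short_words K. weight lam (length w) * (2 * E (length w)) ^ CARD('n))"
    using room by (subst Bochner_Integration.integral_sum) auto
  also have "\<dots> = (\<Sum>k<K. 2 ^ k * (weight lam k * (2 * E k) ^ CARD('n)))"
    by (rule sum_short_words)
  also have "\<dots> = (\<Sum>k<K. (2 * \<epsilon>) ^ CARD('n))"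
  proof (rule sum.cong)
    fix k
    define X where "X = \<kappa> ^ k"
    have X: "0 < X" using kpow_pos[of k] by (simp add: X_def)
    have "X powr lam = (1 / 2) ^ k" unfolding X_def kpow_powr lam by simp
    then have "2 ^ k * (X powr (lam - real CARD('n)) * X ^ CARD('n)) = 1"
      using X by (simp add: powr_diff powr_realpow power_one_over)
    then show "2 ^ k * (weight lam k * (2 * E k) ^ CARD('n)) = (2 * \<epsilon>) ^ CARD('n)"
      by (simp add: weight_def E_def X_def[symmetric] power_mult_distrib mult_ac)
  qed simp
  finally have "real K * (2 * \<epsilon>) ^ CARD('n) \<le> (\<integral>x. indicator G x * ?u x \<partial>lborel)" by simp
  also have "\<dots> = (LINT x:G|lebesgue. ?u x)"
    by (simp add: set_lebesgue_integral_def integral_completion)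
  finally show ?thesis
    by (simp add: mean_over_def divide_right_mono)
qed

lemma mean_deviation_test_fun_ge:
  assumes lam: "\<kappa> powr lam = 1 / 2"
  shows "\<exists>c>0. \<forall>K. ennreal (real K * c)
    \<le> (\<integral>\<^sup>+ x. ennreal \<bar>test_fun lam K x - mean_over G (test_fun lam K)\<bar> * indicator G x \<partial>lborel)"
proof (intro exI conjI allI)
  let ?b = "measure lborel (bar [])" and ?g = "measure lborel G"
  have pos: "0 < ?b" "0 < ?g" using bar_root_positive by auto
  show "0 < (2 * \<epsilon>) ^ CARD('n) / ?g * ?b" using pos eps_pos by simp
  fix K
  let ?u = "test_fun lam K"
  have "ennreal (real K * ((2 * \<epsilon>) ^ CARD('n) / ?g * ?b)) \<le> ennreal (mean_over G ?u * ?b)"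
    using mult_right_mono[OF mean_test_fun_ge[OF lam, of K], of ?b] pos by (intro ennreal_leI) simp
  also have "\<dots> \<le> ennreal \<bar>mean_over G ?u\<bar> * ennreal ?b"
    by (simp add: mult_right_mono ennreal_leI flip: ennreal_mult)
  also have "ennreal ?b = emeasure lborel (bar [])"
    by (intro emeasure_eq_ennreal_measure[symmetric]) (simp add: bar_def obox_eq_box emeasure_lborel_box_eq)
  also have "ennreal \<bar>mean_over G ?u\<bar> * emeasure lborel (bar [])
      = (\<integral>\<^sup>+ x. ennreal \<bar>mean_over G ?u\<bar> * indicator (bar []) x \<partial>lborel)"
    by (simp add: nn_integral_cmult_indicator bar_def)
  also have "\<dots> \<le> (\<integral>\<^sup>+ x. ennreal \<bar>?u x - mean_over G ?u\<bar> * indicator G x \<partial>lborel)"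
    using branch_subset_G(2)[of "[]"]
    by (intro nn_integral_mono) (auto simp: test_fun_bar_root split: split_indicator)
  finally show "ennreal (real K * ((2 * \<epsilon>) ^ CARD('n) / ?g * ?b))
    \<le> (\<integral>\<^sup>+ x. ennreal \<bar>?u x - mean_over G ?u\<bar> * indicator G x \<partial>lborel)" .
qed

lemma not_fractional_poincare_G:
  assumes lam: "\<kappa> powr lam = 1 / 2"
    and P: "1 < P" and \<delta>: "0 < \<delta>" "\<delta> < 1" and \<tau>: "0 < \<tau>" "\<tau> < 1"
    and crit: "P * (real CARD('n) + 1 - lam - s * (1 - \<delta>)) \<le> s * (real CARD('n) - 1) - lam + 1"
  shows "\<not> fractional_poincare P \<delta> \<tau> G"
proof
  assume "fractional_poincare P \<delta> \<tau> G"
  then obtain c0 :: real where c0: "\<And>u. in_Lp P G u \<Longrightarrow>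
      (\<integral>\<^sup>+ x. ennreal \<bar>u x - mean_over G u\<bar> * indicator G x \<partial>lborel)
        \<le> ennreal c0 * enn_powr (energy P \<delta> \<tau> u) (1 / P)"
    unfolding fractional_poincare_def nn_integral_completion energy_def by auto
  obtain C where C: "0 \<le> C" "\<And>K. energy P \<delta> \<tau> (test_fun lam K) \<le> ennreal (real K * C)"
    using energy_test_fun_le[OF assms] by blast
  obtain c where c: "0 < c" "\<And>K. ennreal (real K * c)
    \<le> (\<integral>\<^sup>+ x. ennreal \<bar>test_fun lam K x - mean_over G (test_fun lam K)\<bar> * indicator G x \<partial>lborel)"
    using mean_deviation_test_fun_ge[OF lam] by blast
  \<comment> \<open>\<open>ennreal\<close> sends a negative \<open>c0\<close> to 0, hence the
    maximum.\<close>
  define D where "D = max c0 0 * C powr (1 / P)"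
  have D: "0 \<le> D" by (simp add: D_def)
  have bound: "real K * c \<le> D * real K powr (1 / P)" for K
  proof -
    let ?e = "energy P \<delta> \<tau> (test_fun lam K)"
    have fin: "?e < \<infinity>" using C(2)[of K] by (simp add: le_less_trans)
    then have "enn2real ?e \<le> real K * C"
      using enn2real_mono[OF C(2)[of K]] C(1) by simp
    then have "enn2real ?e powr (1 / P) \<le> (real K * C) powr (1 / P)"
      using P by (intro powr_mono2) auto
    then have "enn_powr ?e (1 / P) \<le> ennreal ((real K * C) powr (1 / P))"
      using fin by (auto simp: enn_powr_def ennreal_leI)
    then have "ennreal c0 * enn_powr ?e (1 / P) \<le> ennreal (max c0 0) * ennreal ((real K * C) powr (1 / P))"
      by (intro mult_mono ennreal_leI) auto
    also have "\<dots> = ennreal (D * real K powr (1 / P))"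
      using C(1) by (simp add: D_def powr_mult mult_ac flip: ennreal_mult)
    finally have "ennreal (real K * c) \<le> ennreal (D * real K powr (1 / P))"
      using c(2)[of K] c0[OF in_Lp_test_fun, of lam K] P by (meson order_trans less_trans zero_less_one)
    then show ?thesis using D by (simp add: ennreal_le_iff)
  qed
  define b where "b = 1 - 1 / P"
  have b: "0 < b" using P by (simp add: b_def)
  \<comment> \<open>The second bound makes \<open>c * real K powr b\<close> exceed \<open>D\<close>;
    the first makes \<open>real K\<close> positive, so that the strict inequality survives
    multiplication by \<open>real K powr (1 / P)\<close>.\<close>
  obtain K where K: "max 1 ((D / c + 1) powr (1 / b)) \<le> real K" using real_arch_simple by blast
  have "D / c + 1 = ((D / c + 1) powr (1 / b)) powr b"
    using b D c(1) by (simp add: powr_powr add_nonneg_pos)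
  also have "\<dots> \<le> real K powr b" using K b by (intro powr_mono2) auto
  finally have "D < c * real K powr b" using c(1) by (simp add: field_simps)
  moreover have "0 < real K powr (1 / P)" using K by simp
  ultimately have "D * real K powr (1 / P) < c * real K powr b * real K powr (1 / P)"
    by (rule mult_strict_right_mono)
  also have "\<dots> = c * real K" using K by (simp add: b_def flip: powr_add)
  finally have "D * real K powr (1 / P) < real K * c" by (simp add: mult.commute)
  then show False using bound[of K] by simp
qed

end

theorem theorem6p3:
  fixes s p lam \<delta> \<tau> :: real
  assumes "CARD('n) \<ge> 2"
    and "s > 1" and "1 < p"
    and "real CARD('n) - 1 \<le> lam" and "lam < real CARD('n)"
    and "0 < \<delta>" and "\<delta> < 1" and "0 < \<tau>" and "\<tau> < 1"
    and "s < (real CARD('n) + 1 - lam) / (1 - \<delta>)"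
    and "p \<le> (s * (real CARD('n) - 1) - lam + 1) / (real CARD('n) - s * (1 - \<delta>) - lam + 1)"
  shows "\<exists>G :: (real ^ 'n) set. john_domain s G \<and>
           upper_minkowski_dim (frontier G) = ereal lam \<and>
           \<not> fractional_poincare p \<delta> \<tau> G"
proof -
  obtain idx :: "'n \<Rightarrow> nat" where idx: "bij_betw idx UNIV {..<CARD('n)}"
    using ex_bij_betw_finite_nat[of "UNIV :: 'n set"] by (auto simp: atLeast0LessThan)
  have "0 < lam" using assms by linarith
  define \<kappa> :: real where "\<kappa> = 2 powr - (1 / lam)"
  have \<kappa>: "0 < \<kappa>" "\<kappa> < 1" using \<open>0 < lam\<close> by (auto simp: \<kappa>_def powr_less_one)
  have lam: "\<kappa> powr lam = 1 / 2" 
    unfolding \<kappa>_def powr_powr using \<open>0 < lam\<close> by (simp add: powr_minus)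
  have "\<kappa> ^ CARD('n) = \<kappa> powr real CARD('n)" using \<kappa> by (simp add: powr_realpow)
  also have "\<dots> < \<kappa> powr lam" using \<kappa> assms by (intro powr_less_mono') auto
  finally have "\<kappa> ^ CARD('n) < 1 / 2" using lam by simp
  then interpret room_tree idx \<kappa> s
    using idx \<kappa> assms by unfold_locales auto
  \<comment> \<open>The bound on s makes the denominator in the bound on p positive, so that the
    fraction can be cleared.\<close>
  have "0 < real CARD('n) - s * (1 - \<delta>) - lam + 1"
    using assms(7,10) by (simp add: field_simps)
  then have "p * (real CARD('n) + 1 - lam - s * (1 - \<delta>)) \<le> s * (real CARD('n) - 1) - lam + 1"
    using assms(11) by (simp add: pos_le_divide_eq algebra_simps)
  then show ?thesis
    using john_domain_G upper_minkowski_dim_frontier_G[OF lam] not_fractional_poincare_G[OF lam] assms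
    by blast
qed

end
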